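(* Let $E\subset\mathbb{R}^n$ be a bounded measurable set and $p\in[1,\infty)$. Suppose that there exists a positive constant $c$ such that for all dyadic cubes $P$ satisfying $|P|\le 1$ and all $t\in(0,1)$ $$\sup_{\{h\in\mathbb{R}^n:\, t/2<|h|<t\}} \left\| \Delta_h^1 {\bf 1}_E \right\|_{L^1 (P)}\le c\, t \, [\ell (P)]^{n-1}.$$ (i) If $\tau \in(0,\frac{n-1}{np}]$, then ${\bf 1}_E$ belongs to $B^{1/p,\tau}_{p,\infty} (\mathbb{R}^n)$. (ii) If $\tau\in(\frac{n-1}{np},\frac 1p)$, then ${\bf 1}_E$ belongs to $B^{s,\tau}_{p,q} (\mathbb{R}^n)$ with $s:= n(\frac 1p - \tau)$ and all $q\in [1,\infty]$.
   Context: ${\bf 1}_E$ is the characteristic function of $E$, and $\Delta_h^1f(x):=f(x+h)-f(x)$. Dyadic cubes: for $j\in\mathbb{Z}$, $k\in\mathbb{Z}^n$ let $Q_{j,k}:=2^{-j}([0,1)^n+k)$; $\mathcal{Q}$ is the set of all of them; $\ell(P)$ is the edge length of $P$ and $j_P:=-\log_2\ell(P)$. Function spaces: fix $\varphi_0,\varphi\in\mathcal{S}(\mathbb{R}^n)$ with real-valued nonnegative Fourier transforms such that $\mathrm{supp}\,\mathcal{F}\varphi_0\subset\{|\xi|\le 2\}$, $|\mathcal{F}\varphi_0(\xi)|\ge C>0$ for $|\xi|\le 5/3$, $\mathrm{supp}\,\mathcal{F}\varphi\subset\{1/2\le|\xi|\le 2\}$, $|\mathcal{F}\varphi(\xi)|\ge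 C>0$ for $3/5\le|\xi|\le 5/3$; put $\varphi_j:=2^{jn}\varphi(2^j\cdot)$ for $j\ge 1$. For $s\in\mathbb{R}$, $\tau\in[0,\infty)$, $p,q\in(0,\infty]$, the Besov-type space $B^{s,\tau}_{p,q}(\mathbb{R}^n)$ is the set of all $f\in\mathcal{S}'(\mathbb{R}^n)$ with $$\|f\|_{B^{s,\tau}_{p,q}(\mathbb{R}^n)}:=\sup_{P\in\mathcal{Q}}\frac1{|P|^{\tau}}\Big\{\sum_{j=\max\{j_P,0\}}^\infty 2^{js q}\Big[\int_P|\varphi_j\ast f(x)|^p\,dx\Big]^{q/p}\Big\}^{1/q}<\infty,$$ with the usual modifications if $p=\infty$ and/or $q=\infty$. *)

theory Defs
  imports "HOL-Analysis.Analysis" "HOL-Probability.Essential_Supremum"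
begin

section \<open>Schwartz functions and tempered distributions\<close>

definition partial_deriv :: "'n::finite \<Rightarrow> (real^'n \<Rightarrow> complex) \<Rightarrow> real^'n \<Rightarrow> complex" where
  "partial_deriv i f x = frechet_derivative f (at x) (axis i 1)"

text \<open>Derivatives of higher order are indexed by lists of coordinates instead of multi-indices;
  on smooth functions the order of the list is irrelevant.\<close>

definition partial_derivs :: "'n::finite list \<Rightarrow> (real^'n \<Rightarrow> complex) \<Rightarrow> real^'n \<Rightarrow> complex" where
  "partial_derivs is f = foldr partial_deriv is f"

definition schwartz_weight ::
    "nat \<Rightarrow> 'n::finite list \<Rightarrow> (real^'n \<Rightarrow> complex) \<Rightarrow> real^'n \<Rightarrow> real" where
  "schwartz_weight N is f x = (1 + norm x) ^ N * norm (partial_derivs is f x)"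

definition schwartz :: "(real^'n::finite \<Rightarrow> complex) set" where
  "schwartz = {f. \<forall>is. (\<forall>x. partial_derivs is f differentiable (at x)) \<and>
                       (\<forall>N. bounded (range (schwartz_weight N is f)))}"

text \<open>Convergence in the Schwartz topology; it is only used for sequences and limits in
  \<^term>\<open>schwartz\<close>, where the suprema are finite.\<close>

definition schwartz_lim ::
    "(nat \<Rightarrow> real^'n::finite \<Rightarrow> complex) \<Rightarrow> (real^'n \<Rightarrow> complex) \<Rightarrow> bool" where
  "schwartz_lim \<psi> \<psi>' \<longleftrightarrow>
     (\<forall>N is. (\<lambda>k. SUP x. schwartz_weight N is (\<lambda>y. \<psi> k y - \<psi>' y) x) \<longlonglongrightarrow> 0)"

text \<open>The continuous linear functionals on \<^term>\<open>schwartz\<close>. As the Schwartz topology is metrizable,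
  continuity is sequential continuity. The functionals are \<^const>\<open>extensional\<close>, so that
  they are determined by their values on \<^term>\<open>schwartz\<close>.\<close>

definition tempered_distributions :: "((real^'n::finite \<Rightarrow> complex) \<Rightarrow> complex) set" where
  "tempered_distributions = {u \<in> extensional schwartz.
     (\<forall>\<psi>\<in>schwartz. \<forall>\<eta>\<in>schwartz. u (\<lambda>x. \<psi> x + \<eta> x) = u \<psi> + u \<eta>) \<and>
     (\<forall>a. \<forall>\<psi>\<in>schwartz. u (\<lambda>x. a * \<psi> x) = a * u \<psi>) \<and>
     (\<forall>\<psi> \<psi>'. range \<psi> \<subseteq> schwartz \<longrightarrow> \<psi>' \<in> schwartz \<longrightarrow> schwartz_lim \<psi> \<psi>' \<longrightarrow>
        (\<lambda>k. u (\<psi> k)) \<longlonglongrightarrow> u \<psi>')}"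

definition regular_distribution ::
    "(real^'n::finite \<Rightarrow> complex) \<Rightarrow> (real^'n \<Rightarrow> complex) \<Rightarrow> complex" where
  "regular_distribution g = (\<lambda>\<psi>\<in>schwartz. \<integral>x. g x * \<psi> x \<partial>lebesgue)"

definition fourier :: "(real^'n::finite \<Rightarrow> complex) \<Rightarrow> real^'n \<Rightarrow> complex" where
  "fourier f \<xi> = complex_of_real ((2 * pi) powr (- real CARD('n) / 2)) *
     (\<integral>x. exp (- \<i> * complex_of_real (x \<bullet> \<xi>)) * f x \<partial>lebesgue)"

definition convolve :: "(real^'n::finite \<Rightarrow> complex) \<Rightarrow> ((real^'n \<Rightarrow> complex) \<Rightarrow> complex) \<Rightarrow>
    real^'n \<Rightarrow> complex" where
  "convolve \<psi> u x = u (\<lambda>y. \<psi> (x - y))"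

section \<open>Besov-type spaces\<close>

definition edge_length :: "int \<Rightarrow> real" where
  "edge_length j = 2 powi (- j)"

text \<open>The cube \<^term>\<open>dyadic_cube j k\<close> has edge length \<^term>\<open>edge_length j\<close>, hence
  \<open>j\<^sub>P = j\<close> for \<open>P = dyadic_cube j k\<close>; quantifiers over dyadic cubes are
  quantifiers over \<open>j\<close> and \<open>k\<close>.\<close>

definition dyadic_cube :: "int \<Rightarrow> int^'n::finite \<Rightarrow> (real^'n) set" where
  "dyadic_cube j k = {x. \<forall>i. edge_length j * of_int (k $ i) \<le> x $ i \<and>
                             x $ i < edge_length j * (of_int (k $ i) + 1)}"

text \<open>Only exponents \<open>a > 0\<close> are used.\<close>

definition ennreal_powr :: "ennreal \<Rightarrow> real \<Rightarrow> ennreal" where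
  "ennreal_powr x a = (if x = \<infinity> then \<infinity> else ennreal (enn2real x powr a))"

text \<open>The \<open>L\<^sub>p\<close> quasi-norm for \<open>0 < p \<le> \<infinity>\<close> of a function given by its modulus; over a
  counting measure it is the \<open>\<ell>\<^sub>p\<close> quasi-norm.\<close>

definition Lp_norm :: "ennreal \<Rightarrow> 'a measure \<Rightarrow> ('a \<Rightarrow> ennreal) \<Rightarrow> ennreal" where
  "Lp_norm p M g = (if p = \<infinity> then esssup M g
     else ennreal_powr (\<integral>\<^sup>+x. ennreal_powr (g x) (enn2real p) \<partial>M) (1 / enn2real p))"

definition admissible_pair ::
    "(real^'n::finite \<Rightarrow> complex) \<Rightarrow> (real^'n \<Rightarrow> complex) \<Rightarrow> bool" where
  "admissible_pair \<phi>\<^sub>0 \<phi> \<longleftrightarrow>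
     \<phi>\<^sub>0 \<in> schwartz \<and> \<phi> \<in> schwartz \<and>
     (\<forall>\<xi>. fourier \<phi>\<^sub>0 \<xi> \<in> \<real> \<and> 0 \<le> Re (fourier \<phi>\<^sub>0 \<xi>)) \<and>
     (\<forall>\<xi>. fourier \<phi> \<xi> \<in> \<real> \<and> 0 \<le> Re (fourier \<phi> \<xi>)) \<and>
     closure {\<xi>. fourier \<phi>\<^sub>0 \<xi> \<noteq> 0} \<subseteq> {\<xi>. norm \<xi> \<le> 2} \<and>
     (\<exists>C>0. \<forall>\<xi>. norm \<xi> \<le> 5/3 \<longrightarrow> C \<le> norm (fourier \<phi>\<^sub>0 \<xi>)) \<and>
     closure {\<xi>. fourier \<phi> \<xi> \<noteq> 0} \<subseteq> {\<xi>. 1/2 \<le> norm \<xi> \<and> norm \<xi> \<le> 2} \<and>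
     (\<exists>C>0. \<forall>\<xi>. 3/5 \<le> norm \<xi> \<and> norm \<xi> \<le> 5/3 \<longrightarrow> C \<le> norm (fourier \<phi> \<xi>))"

definition dyadic_dilates :: "(real^'n::finite \<Rightarrow> complex) \<Rightarrow> (real^'n \<Rightarrow> complex) \<Rightarrow>
    nat \<Rightarrow> real^'n \<Rightarrow> complex" where
  "dyadic_dilates \<phi>\<^sub>0 \<phi> j =
     (if j = 0 then \<phi>\<^sub>0 else (\<lambda>x. of_real (2 ^ (j * CARD('n))) * \<phi> ((2 ^ j) *\<^sub>R x)))"

definition besov_type_norm :: "(real^'n::finite \<Rightarrow> complex) \<Rightarrow> (real^'n \<Rightarrow> complex) \<Rightarrow>
    real \<Rightarrow> real \<Rightarrow> ennreal \<Rightarrow> ennreal \<Rightarrow> ((real^'n \<Rightarrow> complex) \<Rightarrow> complex) \<Rightarrow> ennreal" where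
  "besov_type_norm \<phi>\<^sub>0 \<phi> s \<tau> p q f =
     (SUP j. SUP k :: int^'n.
        ennreal (1 / measure lebesgue (dyadic_cube j k) powr \<tau>) *
        Lp_norm q (count_space {i :: nat. max j 0 \<le> int i})
          (\<lambda>i. ennreal (2 powr (real i * s)) *
             Lp_norm p (lebesgue_on (dyadic_cube j k))
               (\<lambda>x. ennreal (norm (convolve (dyadic_dilates \<phi>\<^sub>0 \<phi> i) f x)))))"

definition besov_type_space :: "(real^'n::finite \<Rightarrow> complex) \<Rightarrow> (real^'n \<Rightarrow> complex) \<Rightarrow>
    real \<Rightarrow> real \<Rightarrow> ennreal \<Rightarrow> ennreal \<Rightarrow> ((real^'n \<Rightarrow> complex) \<Rightarrow> complex) set" where
  "besov_type_space \<phi>\<^sub>0 \<phi> s \<tau> p q =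
     {f \<in> tempered_distributions. besov_type_norm \<phi>\<^sub>0 \<phi> s \<tau> p q f < \<infinity>}"

definition difference :: "'a::plus \<Rightarrow> ('a \<Rightarrow> 'b::minus) \<Rightarrow> 'a \<Rightarrow> 'b" where
  "difference h f x = f (x + h) - f x"

end

theory Submission
  imports Defs "HOL-Probability.Sinc_Integral"
begin

text \<open>
  Write \<open>f\<close> for the indicator function of \<open>E\<close> and \<open>n\<close> for the dimension. For \<open>i \<ge> 1\<close> the kernel
  \<open>\<phi>\<^sub>i\<close> has mean zero, because its Fourier transform vanishes near the origin. Hence \<open>\<phi>\<^sub>i * f (x)\<close> is
  the integral of \<open>\<phi>\<^sub>i h * (f (x - h) - f x)\<close> over \<open>h\<close>. Its modulus is at most the \<open>L\<^sup>1\<close> norm of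
  \<open>\<phi>\<close>, so its \<open>p\<close>-th power is dominated by its first power, and by Fubini the integral of the \<open>p\<close>-th
  power over a cube \<open>P\<close> is at most a constant times the average of the \<open>L\<^sup>1\<close> norms on \<open>P\<close> of the
  differences of \<open>f\<close>, with weight \<open>\<bar>\<phi>\<^sub>i h\<bar>\<close>
  (\<open>nn_integral_mean_zero_convolution_powr_le\<close>).

  Let \<open>J = max j\<^sub>P 0\<close>. The assumption on short shifts and small cubes extends to all shifts and all
  cubes (\<open>jump_local_le\<close>): the \<open>L\<^sup>1\<close> norm on \<open>P\<close> of the difference with shift \<open>h\<close> is at most a
  constant times \<open>\<bar>h\<bar> * 2 powr (- (n - 1) * J)\<close>. Long shifts are harmless because the trivial bound is
  of this size, large cubes because a bounded set meets only finitely many unit cubes. Since the first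
  absolute moment of \<open>\<phi>\<^sub>i\<close> is \<open>2 powr (- i)\<close> times that of \<open>\<phi>\<close>, the \<open>L\<^sup>p\<close> norm of \<open>\<phi>\<^sub>i * f\<close> on \<open>P\<close> is at
  most a constant times \<open>2 powr (- (i + (n - 1) * J) / p)\<close> for all \<open>i \<ge> J\<close>
  (\<open>Lp_norm_level_le\<close>).

  With the weights \<open>2 powr (i * s)\<close> this is a geometric sequence in \<open>i\<close>. If \<open>s < 1 / p\<close>, or if
  \<open>s = 1 / p\<close> and \<open>q = \<infinity>\<close>, its norm over \<open>i \<ge> J\<close> is comparable to its first term, and multiplication
  by \<open>\<bar>P\<bar> powr (- \<tau>)\<close>, which is at most \<open>2 powr (J * n * \<tau>)\<close>, gives
  \<open>2 powr (J * (s + n * \<tau> - n / p))\<close>. This is bounded as soon as \<open>s + n * \<tau> \<le> n / p\<close>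
  (\<open>besov_type_spaceI\<close>). Both parts of the theorem are special cases.
\<close>

section \<open>Schwartz functions\<close>

lemma partial_derivs_Nil [simp]: "partial_derivs [] f = f"
  by (simp add: partial_derivs_def)

lemma partial_derivs_Cons [simp]:
  "partial_derivs (i # is) f = partial_deriv i (partial_derivs is f)"
  by (simp add: partial_derivs_def)

lemma schwartz_differentiable:
  "f \<in> schwartz \<Longrightarrow> partial_derivs is f differentiable (at x)"
  by (simp add: schwartz_def)

lemma schwartz_bounded_weight:
  "f \<in> schwartz \<Longrightarrow> bounded (range (schwartz_weight N is f))"
  by (simp add: schwartz_def)

lemma schwartz_decay:
  assumes "f \<in> schwartz"
  obtains B where "0 < B" "\<And>x. schwartz_weight N is f x \<le> B"
proof -
  obtain B where "0 < B" "\<And>y. y \<in> range (schwartz_weight N is f) \<Longrightarrow> norm y \<le> B"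
    using schwartz_bounded_weight[OF assms] unfolding bounded_pos by blast
  then have "schwartz_weight N is f x \<le> B" for x
    by (metis abs_le_D1 rangeI real_norm_def)
  with \<open>0 < B\<close> show thesis by (rule that)
qed

lemma schwartzI:
  assumes "\<And>is x. partial_derivs is f differentiable (at x)"
    and "\<And>N is x. schwartz_weight N is f x \<le> B N is"
  shows "f \<in> schwartz"
proof -
  have "bounded (range (schwartz_weight N is f))" for N "is"
  proof -
    have "norm y \<le> B N is" if y: "y \<in> range (schwartz_weight N is f)" for y
    proof -
      obtain x where x: "y = schwartz_weight N is f x" using y by auto
      have "0 \<le> schwartz_weight N is f x" by (simp add: schwartz_weight_def)
      then show ?thesis using assms(2)[of N "is" x] x by simp
    qed
    then show ?thesis unfolding bounded_iff by blast
  qed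
  then show ?thesis using assms(1) by (auto simp: schwartz_def)
qed

lemma schwartz_measurable [measurable]:
  "f \<in> schwartz \<Longrightarrow> f \<in> borel_measurable borel"
  using schwartz_differentiable[of f "[]"]
  by (auto intro!: borel_measurable_continuous_onI simp: continuous_on_eq_continuous_at
      differentiable_imp_continuous_within)

lemma partial_deriv_add:
  assumes "f differentiable (at x)" "g differentiable (at x)"
  shows "partial_deriv i (\<lambda>x. f x + g x) x = partial_deriv i f x + partial_deriv i g x"
  using frechet_derivative_at[OF has_derivative_add[OF assms[unfolded frechet_derivative_works]]]
  by (simp add: partial_deriv_def fun_eq_iff)

text \<open>Multiples, translations, reflections and dilations of a test function are all of the form
  \<open>\<lambda>y. k * f (a *\<^sub>R y + b)\<close>, so one computation covers them.\<close>

lemma partial_deriv_affine: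
  fixes f :: "real^'n::finite \<Rightarrow> complex"
  assumes "\<And>y. f differentiable (at y)"
  shows "partial_deriv i (\<lambda>y. k * f (a *\<^sub>R y + b)) y = k * of_real a * partial_deriv i f (a *\<^sub>R y + b)"
    and "(\<lambda>y. k * f (a *\<^sub>R y + b)) differentiable (at y)"
proof -
  have D: "(f has_derivative frechet_derivative f (at (a *\<^sub>R y + b))) (at (a *\<^sub>R y + b))"
    using assms frechet_derivative_works by blast
  have g: "((\<lambda>y. a *\<^sub>R y + b) has_derivative (\<lambda>v. a *\<^sub>R v)) (at y)"
    by (auto intro!: derivative_eq_intros)
  have c: "((\<lambda>y. f (a *\<^sub>R y + b)) has_derivative
      (\<lambda>v. frechet_derivative f (at (a *\<^sub>R y + b)) (a *\<^sub>R v))) (at y)"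
    using has_derivative_compose[OF g D] .
  have d: "((\<lambda>y. k * f (a *\<^sub>R y + b)) has_derivative
      (\<lambda>v. k * frechet_derivative f (at (a *\<^sub>R y + b)) (a *\<^sub>R v))) (at y)"
    by (rule has_derivative_mult_right[OF c])
  have "linear (frechet_derivative f (at (a *\<^sub>R y + b)))"
    using D has_derivative_linear by blast
  then show "partial_deriv i (\<lambda>y. k * f (a *\<^sub>R y + b)) y = k * of_real a * partial_deriv i f (a *\<^sub>R y + b)"
    unfolding partial_deriv_def frechet_derivative_at[OF d, symmetric]
    by (simp add: linear_scale scaleR_conv_of_real[where 'a=complex])
  show "(\<lambda>y. k * f (a *\<^sub>R y + b)) differentiable (at y)"
    using d differentiable_def by blast
qed

lemma partial_derivs_affine:
  assumes "f \<in> schwartz"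
  shows "partial_derivs is (\<lambda>y. k * f (a *\<^sub>R y + b))
       = (\<lambda>y. k * of_real a ^ length is * partial_derivs is f (a *\<^sub>R y + b))"
proof (induction "is")
  case (Cons i "is")
  show ?case
    using partial_deriv_affine(1)[OF schwartz_differentiable[OF assms],
        of i "k * of_real a ^ length is"]
    by (simp add: Cons fun_eq_iff)
qed simp

lemma partial_derivs_add:
  assumes "f \<in> schwartz" "g \<in> schwartz"
  shows "partial_derivs is (\<lambda>y. f y + g y) = (\<lambda>y. partial_derivs is f y + partial_derivs is g y)"
proof (induction "is")
  case (Cons i "is")
  show ?case
    by (simp add: Cons fun_eq_iff partial_deriv_add schwartz_differentiable assms)
qed simp

lemma schwartz_add:
  assumes f: "f \<in> schwartz" and g: "g \<in> schwartz"
  shows "(\<lambda>y. f y + g y) \<in> schwartz"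
proof -
  have "\<exists>B. \<forall>x. schwartz_weight N is f x \<le> B" "\<exists>B. \<forall>x. schwartz_weight N is g x \<le> B" for N "is"
    using schwartz_decay[OF f] schwartz_decay[OF g] by metis+
  then obtain B C where B: "\<And>N is x. schwartz_weight N is f x \<le> B N is"
    and C: "\<And>N is x. schwartz_weight N is g x \<le> C N is" by metis
  have "schwartz_weight N is (\<lambda>y. f y + g y) x \<le> B N is + C N is" for N "is" x
  proof -
    have "schwartz_weight N is (\<lambda>y. f y + g y) x \<le> schwartz_weight N is f x + schwartz_weight N is g x"
      unfolding schwartz_weight_def partial_derivs_add[OF f g] distrib_left[symmetric]
      by (intro mult_left_mono norm_triangle_ineq) auto
    then show ?thesis using B[of N "is" x] C[of N "is" x] by linarith
  qed
  then show ?thesis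
    by (intro schwartzI) (auto simp: partial_derivs_add f g schwartz_differentiable)
qed

text \<open>The weights are compatible with an affine change of variables because
  \<open>1 + norm y\<close> is at most a constant times \<open>1 + norm (a *\<^sub>R y + b)\<close> when \<open>a \<noteq> 0\<close>.\<close>

lemma schwartz_affine:
  fixes f :: "real^'n::finite \<Rightarrow> complex"
  assumes f: "f \<in> schwartz" and a: "a \<noteq> 0"
  shows "(\<lambda>y. k * f (a *\<^sub>R y + b)) \<in> schwartz"
proof -
  have "\<exists>B. \<forall>x. schwartz_weight N is f x \<le> B" for N "is"
    using schwartz_decay[OF f] by metis
  then obtain B where B: "\<And>N is x. schwartz_weight N is f x \<le> B N is" by metis
  define K where "K = 1 + norm b / \<bar>a\<bar> + 1 / \<bar>a\<bar>"
  have K: "1 + norm y \<le> K * (1 + norm (a *\<^sub>R y + b))" for y :: "real^'n"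
  proof -
    have "norm y = norm (a *\<^sub>R y + b - b) / \<bar>a\<bar>" using a by simp
    also have "\<dots> \<le> (norm (a *\<^sub>R y + b) + norm b) / \<bar>a\<bar>"
      by (intro divide_right_mono norm_triangle_ineq4) auto
    finally have "norm y \<le> norm (a *\<^sub>R y + b) / \<bar>a\<bar> + norm b / \<bar>a\<bar>"
      by (simp add: add_divide_distrib)
    moreover have "0 \<le> norm b / \<bar>a\<bar> * norm (a *\<^sub>R y + b)" "0 \<le> 1 / \<bar>a\<bar>"
      by auto
    moreover have "K * (1 + norm (a *\<^sub>R y + b)) = 1 + norm b / \<bar>a\<bar> + 1 / \<bar>a\<bar> + norm (a *\<^sub>R y + b)
        + norm b / \<bar>a\<bar> * norm (a *\<^sub>R y + b) + norm (a *\<^sub>R y + b) / \<bar>a\<bar>"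
      unfolding K_def by (simp add: distrib_left distrib_right)
    ultimately show ?thesis using norm_ge_zero[of "a *\<^sub>R y + b"] by linarith
  qed
  have K0: "0 \<le> K" unfolding K_def by simp
  have "schwartz_weight N is (\<lambda>y. k * f (a *\<^sub>R y + b)) x
      \<le> K ^ N * (norm k * \<bar>a\<bar> ^ length is) * B N is" for N "is" x
  proof -
    have "schwartz_weight N is (\<lambda>y. k * f (a *\<^sub>R y + b)) x
        = (1 + norm x) ^ N * (norm k * \<bar>a\<bar> ^ length is) * norm (partial_derivs is f (a *\<^sub>R x + b))"
      unfolding schwartz_weight_def partial_derivs_affine[OF f]
      by (simp add: norm_mult norm_power)
    also have "\<dots> \<le> (K * (1 + norm (a *\<^sub>R x + b))) ^ N * (norm k * \<bar>a\<bar> ^ length is)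
        * norm (partial_derivs is f (a *\<^sub>R x + b))"
      by (intro mult_right_mono power_mono K) auto
    also have "\<dots> = K ^ N * (norm k * \<bar>a\<bar> ^ length is) * schwartz_weight N is f (a *\<^sub>R x + b)"
      by (simp add: schwartz_weight_def power_mult_distrib)
    also have "\<dots> \<le> K ^ N * (norm k * \<bar>a\<bar> ^ length is) * B N is"
      by (intro mult_left_mono B) (auto simp: K0)
    finally show ?thesis .
  qed
  moreover have "partial_derivs is (\<lambda>y. k * f (a *\<^sub>R y + b)) differentiable (at x)" for "is" x
    unfolding partial_derivs_affine[OF f]
    by (rule partial_deriv_affine(2)[OF schwartz_differentiable[OF f]])
  ultimately show ?thesis by (intro schwartzI)
qed

lemma schwartz_cmult: "f \<in> schwartz \<Longrightarrow> (\<lambda>y. k * f y) \<in> schwartz"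
  using schwartz_affine[of f 1 k 0] by simp

lemma schwartz_reflect: "f \<in> schwartz \<Longrightarrow> (\<lambda>y. f (x - y)) \<in> schwartz"
  using schwartz_affine[of f "-1" 1 x] by simp

lemma schwartz_dyadic_dilates:
  "\<phi>\<^sub>0 \<in> schwartz \<Longrightarrow> \<phi> \<in> schwartz \<Longrightarrow> dyadic_dilates \<phi>\<^sub>0 \<phi> i \<in> schwartz"
  using schwartz_affine[of \<phi> "2 ^ i" "of_real (2 ^ (i * CARD('a)))" 0]
  by (simp add: dyadic_dilates_def)

lemma nn_integral_inverse_one_plus_square:
  "(\<integral>\<^sup>+x. ennreal (inverse (1 + x\<^sup>2)) \<partial>lborel) < \<infinity>"
proof -
  have "integrable lborel (\<lambda>x::real. inverse (1 + x\<^sup>2))"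
    using integrable_inverse_1_plus_square by (simp add: set_integrable_def)
  then show ?thesis by (simp add: integrable_iff_bounded)
qed

text \<open>A Schwartz function decays faster than the tensor product of the functions
  \<open>1 / (1 + t\<^sup>2)\<close> in the separate coordinates, whose integral is a power of a one-dimensional one.
  The factor \<open>1 + norm x\<close> yields the finiteness of the integral and of the first moment at once.\<close>

lemma nn_integral_schwartz_finite:
  fixes f :: "real^'n::finite \<Rightarrow> complex"
  assumes f: "f \<in> schwartz"
  shows "(\<integral>\<^sup>+x. ennreal ((1 + norm x) * norm (f x)) \<partial>lborel) < \<infinity>"
proof -
  define N where "N = 2 * CARD('n) + 1"
  obtain B where B: "0 < B" "\<And>x. schwartz_weight N [] f x \<le> B" using schwartz_decay[OF f] by metis
  have "ennreal ((1 + norm x) * norm (f x))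
      \<le> ennreal B * (\<Prod>b\<in>Basis. ennreal (inverse (1 + (x \<bullet> b)\<^sup>2)))" for x
  proof -
    have 1: "inverse ((1 + norm x) ^ 2) \<le> inverse (1 + (x \<bullet> b)\<^sup>2)" if "b \<in> Basis" for b
    proof -
      have "(x \<bullet> b)\<^sup>2 \<le> (norm x)\<^sup>2" using Basis_le_norm[OF that, of x] abs_le_square_iff[of "x \<bullet> b" "norm x"] by simp
      also have "1 + (norm x)\<^sup>2 \<le> (1 + norm x)\<^sup>2" by (simp add: power2_sum)
      finally have "1 + (x \<bullet> b)\<^sup>2 \<le> (1 + norm x)\<^sup>2" by simp
      moreover have "0 < 1 + (x \<bullet> b)\<^sup>2" by (simp add: add_pos_nonneg)
      ultimately show ?thesis by (rule le_imp_inverse_le)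
    qed
    have "(1 + norm x) * norm (f x) \<le> B * inverse ((1 + norm x) ^ (2 * CARD('n)))"
    proof -
      have "(1 + norm x) * norm (f x) = schwartz_weight N [] f x * inverse ((1 + norm x) ^ (2 * CARD('n)))"
        using add_pos_nonneg[OF zero_less_one norm_ge_zero, of x]
        by (simp add: schwartz_weight_def N_def field_simps)
      also have "\<dots> \<le> B * inverse ((1 + norm x) ^ (2 * CARD('n)))"
        by (intro mult_right_mono B) auto
      finally show ?thesis .
    qed
    also have "inverse ((1 + norm x) ^ (2 * CARD('n))) = (\<Prod>b\<in>(Basis::(real^'n) set). inverse ((1 + norm x) ^ 2))"
      by (simp add: power_mult power_inverse)
    also have "\<dots> \<le> (\<Prod>b\<in>Basis. inverse (1 + (x \<bullet> b)\<^sup>2))"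
      by (intro prod_mono) (use 1 in auto)
    finally have "(1 + norm x) * norm (f x) \<le> B * (\<Prod>b\<in>Basis. inverse (1 + (x \<bullet> b)\<^sup>2))"
      using B(1) by simp
    then show ?thesis
      using B(1) by (simp add: prod_ennreal ennreal_mult[symmetric] prod_nonneg ennreal_leI)
  qed
  then have "(\<integral>\<^sup>+x. ennreal ((1 + norm x) * norm (f x)) \<partial>lborel)
      \<le> (\<integral>\<^sup>+x. ennreal B * (\<Prod>b\<in>Basis. ennreal (inverse (1 + ((x::real^'n) \<bullet> b)\<^sup>2))) \<partial>lborel)"
    by (intro nn_integral_mono)
  also have "\<dots> = ennreal B * (\<Prod>b\<in>(Basis::(real^'n) set). (\<integral>\<^sup>+x. ennreal (inverse (1 + x\<^sup>2)) \<partial>lborel))"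
    using nn_integral_lborel_prod[where 'a="real^'n" and f="\<lambda>_ x. ennreal (inverse (1 + x\<^sup>2))"]
    by (subst nn_integral_cmult) auto
  also have "\<dots> < \<infinity>"
    using nn_integral_inverse_one_plus_square by (auto simp: ennreal_mult_less_top power_less_top_ennreal)
  finally show ?thesis .
qed

lemma nn_integral_affine:
  fixes g :: "'a::euclidean_space \<Rightarrow> ennreal"
  assumes [measurable]: "g \<in> borel_measurable borel" and "c \<noteq> 0"
  shows "(\<integral>\<^sup>+x. g x \<partial>lborel) = ennreal (\<bar>c\<bar> ^ DIM('a)) * (\<integral>\<^sup>+x. g (t + c *\<^sub>R x) \<partial>lborel)"
  by (subst lborel_affine[OF \<open>c \<noteq> 0\<close>, of t])
     (simp add: nn_integral_density nn_integral_distr nn_integral_cmult)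

section \<open>Convolution of an indicator function with an integrable kernel\<close>

lemma integral_affine:
  fixes g :: "'a::euclidean_space \<Rightarrow> 'b::{banach, second_countable_topology}"
  assumes [measurable]: "g \<in> borel_measurable borel" and "c \<noteq> 0"
  shows "(\<integral>x. g x \<partial>lborel) = (\<bar>c\<bar> ^ DIM('a)) *\<^sub>R (\<integral>x. g (t + c *\<^sub>R x) \<partial>lborel)"
  by (subst lborel_affine[OF \<open>c \<noteq> 0\<close>, of t])
     (simp add: integral_density integral_distr)

abbreviation (input) jump :: "(real^'n::finite) set \<Rightarrow> real^'n \<Rightarrow> real^'n \<Rightarrow> ennreal" where
  "jump E h x \<equiv> ennreal \<bar>difference h (indicat_real E) x\<bar>"

lemma jump_le_1: "jump E h x \<le> 1"
  by (auto simp: difference_def split: split_indicator)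

lemma measurable_jump [measurable]:
  assumes [measurable]: "E \<in> sets borel" "f \<in> borel_measurable M" "g \<in> borel_measurable M"
  shows "(\<lambda>z. jump E (f z) (g z)) \<in> borel_measurable M"
  unfolding difference_def by measurable

text \<open>Since \<open>\<psi>\<close> has mean zero, the constant \<open>indicator E x\<close> may be subtracted under the integral, which
  turns the convolution into an average of differences of the indicator function.\<close>

lemma norm_convolution_indicator_le:
  fixes \<psi> :: "real^'n::finite \<Rightarrow> complex"
  assumes [measurable]: "\<psi> \<in> borel_measurable borel" "E \<in> sets borel"
    and int: "(\<integral>\<^sup>+h. ennreal (norm (\<psi> h)) \<partial>lborel) < \<infinity>" and zero: "(\<integral>h. \<psi> h \<partial>lborel) = 0"
  shows "ennreal (norm (\<integral>y. indicator E y * \<psi> (x - y) \<partial>lborel))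
    \<le> (\<integral>\<^sup>+h. ennreal (norm (\<psi> h)) * jump E (- h) x \<partial>lborel)"
proof -
  have i: "integrable lborel \<psi>" using int by (simp add: integrable_iff_bounded)
  have i1: "integrable lborel (\<lambda>h. indicator E (x - h) * \<psi> h)"
    by (rule Bochner_Integration.integrable_bound[OF i]) (auto simp: norm_mult split: split_indicator)
  have i2: "integrable lborel (\<lambda>h. indicator E x * \<psi> h)" using i by simp
  have "(\<integral>y. indicator E y * \<psi> (x - y) \<partial>lborel) = (\<integral>h. indicator E (x - h) * \<psi> h \<partial>lborel)"
    by (subst integral_affine[where c="-1" and t=x]) auto
  also have "\<dots> = (\<integral>h. indicator E (x - h) * \<psi> h - indicator E x * \<psi> h \<partial>lborel)"
    by (subst Bochner_Integration.integral_diff[OF i1 i2]) (simp add: zero)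
  also have "ennreal (norm \<dots>) \<le> (\<integral>\<^sup>+h. ennreal (norm (indicator E (x - h) * \<psi> h - indicator E x * \<psi> h)) \<partial>lborel)"
    using i1 i2 by (intro integral_norm_bound_ennreal) auto
  also have "\<dots> = (\<integral>\<^sup>+h. ennreal (norm (\<psi> h)) * jump E (- h) x \<partial>lborel)"
    by (intro nn_integral_cong) (auto simp: difference_def split: split_indicator)
  finally show ?thesis .
qed

text \<open>The analytic core. From \<open>G \<le> 1\<close> it follows that \<open>v \<le> A\<close> pointwise, so that
  \<open>v powr p \<le> A powr (p - 1) * v\<close>: for functions that come from an indicator, an \<open>L\<^sup>1\<close> bound already
  gives the \<open>L\<^sup>p\<close> bound. What remains is linear in \<open>v\<close> and is evaluated by interchanging the two
  integrations.\<close>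

lemma nn_integral_powr_le_of_kernel:
  fixes G :: "'a::euclidean_space \<Rightarrow> 'a \<Rightarrow> ennreal" and w :: "'a \<Rightarrow> ennreal"
  assumes w [measurable]: "w \<in> borel_measurable borel"
    and G: "(\<lambda>(h, x). G h x) \<in> borel_measurable (borel \<Otimes>\<^sub>M borel)" and G1: "\<And>h x. G h x \<le> 1"
    and P [measurable]: "P \<in> sets borel"
    and v: "\<And>x. 0 \<le> v x" "\<And>x. ennreal (v x) \<le> (\<integral>\<^sup>+h. w h * G h x \<partial>lborel)"
    and A: "(\<integral>\<^sup>+h. w h \<partial>lborel) \<le> ennreal A" "0 \<le> A"
    and B: "(\<integral>\<^sup>+h. w h * (\<integral>\<^sup>+x\<in>P. G h x \<partial>lborel) \<partial>lborel) \<le> ennreal B" "0 \<le> B"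
    and p: "1 \<le> p"
  shows "(\<integral>\<^sup>+x\<in>P. ennreal (v x powr p) \<partial>lborel) \<le> ennreal (A powr (p - 1) * B)"
proof -
  have Gx [measurable]: "(\<lambda>h. G h x) \<in> borel_measurable borel" for x
    using measurable_compose[OF _ G, of "\<lambda>h. (h, x)" borel] by simp
  have Gh [measurable]: "(\<lambda>x. G h x) \<in> borel_measurable borel" for h
    using measurable_compose[OF _ G, of "\<lambda>x. (h, x)" borel] by simp
  have Gs [measurable]: "(\<lambda>z. G (snd z) (fst z)) \<in> borel_measurable (borel \<Otimes>\<^sub>M borel)"
    using measurable_compose[OF _ G, of "\<lambda>z. (snd z, fst z)" "borel \<Otimes>\<^sub>M borel"] by simp
  have Gs' [measurable]: "(\<lambda>z. G (fst z) (snd z)) \<in> borel_measurable (borel \<Otimes>\<^sub>M borel)"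
    using G by (simp add: split_beta')
  have vA: "v x \<le> A" for x
  proof -
    have "ennreal (v x) \<le> (\<integral>\<^sup>+h. w h * G h x \<partial>lborel)" by (rule v)
    also have "\<dots> \<le> (\<integral>\<^sup>+h. w h * 1 \<partial>lborel)"
      by (intro nn_integral_mono mult_left_mono G1) auto
    finally have "ennreal (v x) \<le> ennreal A" using A(1) by simp
    then show ?thesis using A(2) by simp
  qed
  have m: "(\<integral>\<^sup>+h. w h * (G h x * indicator P x) \<partial>lborel)
      = (\<integral>\<^sup>+h. w h * G h x \<partial>lborel) * indicator P x" for x
    unfolding mult.assoc[symmetric] by (rule nn_integral_multc) measurable
  have "(\<integral>\<^sup>+x\<in>P. ennreal (v x powr p) \<partial>lborel)
      \<le> (\<integral>\<^sup>+x\<in>P. (ennreal (A powr (p - 1)) * (\<integral>\<^sup>+h. w h * G h x \<partial>lborel)) \<partial>lborel)"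
  proof (intro nn_integral_mono mult_right_mono)
    fix x
    have "v x powr p = v x powr (p - 1) * v x"
      using powr_add[of "v x" "p - 1" 1] v(1)[of x] by simp
    also have "\<dots> \<le> A powr (p - 1) * v x"
      using p vA[of x] v(1)[of x] by (intro mult_right_mono powr_mono2) auto
    finally have "ennreal (v x powr p) \<le> ennreal (A powr (p - 1)) * ennreal (v x)"
      using v(1)[of x] by (simp add: ennreal_mult[symmetric] ennreal_leI)
    also have "\<dots> \<le> ennreal (A powr (p - 1)) * (\<integral>\<^sup>+h. w h * G h x \<partial>lborel)"
      by (intro mult_left_mono v) auto
    finally show "ennreal (v x powr p) \<le> \<dots>" .
  qed auto
  also have "\<dots> = ennreal (A powr (p - 1)) *
      (\<integral>\<^sup>+x. (\<integral>\<^sup>+h. w h * (G h x * indicator P x) \<partial>lborel) \<partial>lborel)"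
    by (subst nn_integral_cmult[symmetric]) (simp_all add: m mult.assoc)
  also have "(\<integral>\<^sup>+x. (\<integral>\<^sup>+h. w h * (G h x * indicator P x) \<partial>lborel) \<partial>lborel)
      = (\<integral>\<^sup>+h. (\<integral>\<^sup>+x. w h * (G h x * indicator P x) \<partial>lborel) \<partial>lborel)"
    by (rule lborel_pair.Fubini') measurable
  also have "\<dots> = (\<integral>\<^sup>+h. w h * (\<integral>\<^sup>+x\<in>P. G h x \<partial>lborel) \<partial>lborel)"
    by (simp add: nn_integral_cmult)
  also have "ennreal (A powr (p - 1)) * \<dots> \<le> ennreal (A powr (p - 1)) * ennreal B"
    by (intro mult_left_mono B) auto
  finally show ?thesis using B(2) by (simp add: ennreal_mult)
qed

text \<open>Because the differences are controlled by a multiple of the length of the shift, the kernel enters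
  only through its first absolute moment. For the dilate of order \<open>i\<close> this moment carries the factor
  \<open>(1/2) ^ i\<close>, which is the only source of decay in \<open>i\<close>.\<close>

lemma nn_integral_mean_zero_convolution_powr_le:
  fixes \<psi> :: "real^'n::finite \<Rightarrow> complex"
  assumes \<psi> [measurable]: "\<psi> \<in> borel_measurable borel" and E [measurable]: "E \<in> sets borel"
    and P: "P \<in> sets borel"
    and A: "(\<integral>\<^sup>+h. ennreal (norm (\<psi> h)) \<partial>lborel) \<le> ennreal A" "0 \<le> A"
    and B: "(\<integral>\<^sup>+h. ennreal (norm h * norm (\<psi> h)) \<partial>lborel) \<le> ennreal B" "0 \<le> B"
    and zero: "(\<integral>h. \<psi> h \<partial>lborel) = 0"
    and p: "1 \<le> p" and K: "0 \<le> K" "\<And>h. (\<integral>\<^sup>+x\<in>P. jump E h x \<partial>lborel) \<le> ennreal (K * norm h)"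
  shows "(\<integral>\<^sup>+x\<in>P. ennreal (norm (\<integral>y. indicator E y * \<psi> (x - y) \<partial>lborel) powr p) \<partial>lborel)
    \<le> ennreal (A powr (p - 1) * (K * B))"
proof (rule nn_integral_powr_le_of_kernel[where G="\<lambda>h. jump E (- h)" and w="\<lambda>h. ennreal (norm (\<psi> h))"])
  show "ennreal (norm (\<integral>y. indicator E y * \<psi> (x - y) \<partial>lborel))
      \<le> (\<integral>\<^sup>+h. ennreal (norm (\<psi> h)) * jump E (- h) x \<partial>lborel)" for x
    using A by (intro norm_convolution_indicator_le zero) (auto intro: le_less_trans)
  have "(\<integral>\<^sup>+h. ennreal (norm (\<psi> h)) * (\<integral>\<^sup>+x\<in>P. jump E (- h) x \<partial>lborel) \<partial>lborel)
      \<le> (\<integral>\<^sup>+h. ennreal (norm (\<psi> h)) * ennreal (K * norm h) \<partial>lborel)"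
    using K(2)[of "- h" for h] by (intro nn_integral_mono mult_left_mono) auto
  also have "\<dots> = ennreal K * (\<integral>\<^sup>+h. ennreal (norm h * norm (\<psi> h)) \<partial>lborel)"
    using K(1) by (subst nn_integral_cmult[symmetric])
      (auto intro!: nn_integral_cong simp: ennreal_mult[symmetric] mult_ac)
  also have "\<dots> \<le> ennreal K * ennreal B"
    by (intro mult_left_mono B) auto
  finally show "(\<integral>\<^sup>+h. ennreal (norm (\<psi> h)) * (\<integral>\<^sup>+x\<in>P. jump E (- h) x \<partial>lborel) \<partial>lborel)
      \<le> ennreal (K * B)" using K(1) B(2) by (simp add: ennreal_mult)
  show "(\<lambda>(h, x). jump E (- h) x) \<in> borel_measurable (borel \<Otimes>\<^sub>M borel)" by measurable
  show "jump E (- h) x \<le> 1" for h x by (rule jump_le_1)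
qed (use A B K(1) P p in auto)

text \<open>Without cancellation one still has the size estimate; it serves for \<open>\<phi>\<^sub>0\<close>, whose mean does not
  vanish.\<close>

lemma nn_integral_convolution_powr_le:
  fixes \<psi> :: "real^'n::finite \<Rightarrow> complex"
  assumes \<psi> [measurable]: "\<psi> \<in> borel_measurable borel" and E [measurable]: "E \<in> sets borel"
    and V: "emeasure lborel E \<le> ennreal V" "0 \<le> V"
    and A: "(\<integral>\<^sup>+h. ennreal (norm (\<psi> h)) \<partial>lborel) \<le> ennreal A" "0 \<le> A" and p: "1 \<le> p"
  shows "(\<integral>\<^sup>+x. ennreal (norm (\<integral>y. indicator E y * \<psi> (x - y) \<partial>lborel) powr p) \<partial>lborel)
    \<le> ennreal (A powr (p - 1) * (V * A))"
proof -
  have i: "integrable lborel \<psi>" using A by (auto simp: integrable_iff_bounded intro: le_less_trans)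
  have tr: "(\<integral>\<^sup>+x\<in>UNIV. indicator E (x - h) \<partial>lborel) = emeasure lborel E" for h
    using nn_integral_affine[of "indicator E" 1 "- h"] by simp
  have "(\<integral>\<^sup>+x\<in>UNIV. ennreal (norm (\<integral>y. indicator E y * \<psi> (x - y) \<partial>lborel) powr p) \<partial>lborel)
      \<le> ennreal (A powr (p - 1) * (V * A))"
  proof (rule nn_integral_powr_le_of_kernel[where G="\<lambda>h x. indicator E (x - h)" and w="\<lambda>h. ennreal (norm (\<psi> h))"])
    fix x
    have "integrable lborel (\<lambda>h. indicator E (x - h) * \<psi> h)"
      by (rule Bochner_Integration.integrable_bound[OF i]) (auto simp: norm_mult split: split_indicator)
    then have "ennreal (norm (\<integral>h. indicator E (x - h) * \<psi> h \<partial>lborel))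
        \<le> (\<integral>\<^sup>+h. ennreal (norm (indicator E (x - h) * \<psi> h)) \<partial>lborel)"
      by (rule integral_norm_bound_ennreal)
    moreover have "(\<integral>y. indicator E y * \<psi> (x - y) \<partial>lborel) = (\<integral>h. indicator E (x - h) * \<psi> h \<partial>lborel)"
      by (subst integral_affine[where c="-1" and t=x]) auto
    ultimately have "ennreal (norm (\<integral>y. indicator E y * \<psi> (x - y) \<partial>lborel))
        \<le> (\<integral>\<^sup>+h. ennreal (norm (indicator E (x - h) * \<psi> h)) \<partial>lborel)"
      by (simp only:)
    also have "\<dots> = (\<integral>\<^sup>+h. ennreal (norm (\<psi> h)) * indicator E (x - h) \<partial>lborel)"
      by (intro nn_integral_cong) (auto split: split_indicator)
    finally show "ennreal (norm (\<integral>y. indicator E y * \<psi> (x - y) \<partial>lborel)) \<le> \<dots>" .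
  next
    have "(\<integral>\<^sup>+h. ennreal (norm (\<psi> h)) * emeasure lborel E \<partial>lborel)
        = (\<integral>\<^sup>+h. ennreal (norm (\<psi> h)) \<partial>lborel) * emeasure lborel E"
      by (rule nn_integral_multc) measurable
    also have "\<dots> \<le> ennreal A * ennreal V"
      by (intro mult_mono V A) auto
    finally show "(\<integral>\<^sup>+h. ennreal (norm (\<psi> h)) * (\<integral>\<^sup>+x\<in>UNIV. indicator E (x - h) \<partial>lborel) \<partial>lborel)
      \<le> ennreal (V * A)" unfolding tr using V A by (simp add: ennreal_mult mult.commute)
  next
    show "(\<lambda>(h, x). indicator E (x - h) :: ennreal) \<in> borel_measurable (borel \<Otimes>\<^sub>M borel)" by measurable
  qed (use A V p in \<open>auto split: split_indicator\<close>)
  then show ?thesis by simp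
qed

section \<open>Moments of the dyadic dilates\<close>

lemma admissible_pairD:
  assumes "admissible_pair \<phi>\<^sub>0 \<phi>"
  shows "\<phi>\<^sub>0 \<in> schwartz" "\<phi> \<in> schwartz"
    and "closure {\<xi>. fourier \<phi> \<xi> \<noteq> 0} \<subseteq> {\<xi>. 1/2 \<le> norm \<xi> \<and> norm \<xi> \<le> 2}"
proof -
  note a = assms[unfolded admissible_pair_def]
  show "\<phi>\<^sub>0 \<in> schwartz" using a by (elim conjE)
  show "\<phi> \<in> schwartz" using a by (elim conjE)
  show "closure {\<xi>. fourier \<phi> \<xi> \<noteq> 0} \<subseteq> {\<xi>. 1/2 \<le> norm \<xi> \<and> norm \<xi> \<le> 2}"
    using a by (elim conjE)
qed

text \<open>The integral is a multiple of the Fourier transform at the origin, and the origin lies outside the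
  annulus that carries the Fourier transform.\<close>

lemma integral_admissible_eq_0:
  assumes "admissible_pair \<phi>\<^sub>0 \<phi>"
  shows "(\<integral>x. \<phi> x \<partial>lborel) = 0"
proof -
  have [measurable]: "\<phi> \<in> borel_measurable borel"
    by (rule schwartz_measurable[OF admissible_pairD(2)[OF assms]])
  have "fourier \<phi> 0 = 0"
  proof (rule ccontr)
    assume "fourier \<phi> 0 \<noteq> 0"
    then have "0 \<in> closure {\<xi>. fourier \<phi> \<xi> \<noteq> 0}"
      by (intro subsetD[OF closure_subset]) simp
    then have "(0::real^'a) \<in> {\<xi>. 1/2 \<le> norm \<xi> \<and> norm \<xi> \<le> 2}"
      by (rule subsetD[OF admissible_pairD(3)[OF assms], rotated])
    then show False by simp
  qed
  then have "(\<integral>x. \<phi> x \<partial>lebesgue) = 0" by (simp add: fourier_def)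
  then show ?thesis by (simp add: integral_completion)
qed

lemma dyadic_dilates_moments:
  fixes \<phi> :: "real^'n::finite \<Rightarrow> complex"
  assumes [measurable]: "\<phi> \<in> borel_measurable borel" and i: "0 < i"
  shows "(\<integral>\<^sup>+x. ennreal (norm (dyadic_dilates \<phi>\<^sub>0 \<phi> i x)) \<partial>lborel) = (\<integral>\<^sup>+x. ennreal (norm (\<phi> x)) \<partial>lborel)"
    and "(\<integral>\<^sup>+x. ennreal (norm x * norm (dyadic_dilates \<phi>\<^sub>0 \<phi> i x)) \<partial>lborel)
       = ennreal ((1/2) ^ i) * (\<integral>\<^sup>+x. ennreal (norm x * norm (\<phi> x)) \<partial>lborel)"
    and "(\<integral>x. dyadic_dilates \<phi>\<^sub>0 \<phi> i x \<partial>lborel) = (\<integral>x. \<phi> x \<partial>lborel)"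
proof -
  have d: "dyadic_dilates \<phi>\<^sub>0 \<phi> i = (\<lambda>x. of_real (2 ^ (i * CARD('n))) * \<phi> (2 ^ i *\<^sub>R x))"
    using i by (simp add: dyadic_dilates_def)
  have pw: "\<bar>2 ^ i\<bar> ^ DIM(real^'n) = (2 ^ (i * CARD('n)) :: real)"
    by (simp add: power_mult)
  have e0: "ennreal (norm (dyadic_dilates \<phi>\<^sub>0 \<phi> i x))
      = ennreal (2 ^ (i * CARD('n))) * ennreal (norm (\<phi> (0 + 2 ^ i *\<^sub>R x)))" for x
    unfolding d norm_mult by (subst ennreal_mult[symmetric]) (auto simp: norm_power)
  show "(\<integral>\<^sup>+x. ennreal (norm (dyadic_dilates \<phi>\<^sub>0 \<phi> i x)) \<partial>lborel) = (\<integral>\<^sup>+x. ennreal (norm (\<phi> x)) \<partial>lborel)"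
    unfolding e0 pw[symmetric]
    by (subst nn_integral_affine[where c="2 ^ i" and t=0 and g="\<lambda>x. ennreal (norm (\<phi> x))"])
       (auto intro!: nn_integral_cmult)
  have e1: "ennreal (norm x * norm (dyadic_dilates \<phi>\<^sub>0 \<phi> i x))
      = ennreal ((1/2) ^ i * 2 ^ (i * CARD('n))) *
        ennreal (norm (0 + 2 ^ i *\<^sub>R x) * norm (\<phi> (0 + 2 ^ i *\<^sub>R x)))" for x
    unfolding d norm_mult by (subst ennreal_mult[symmetric]) (auto simp: norm_power power_one_over)
  have "(\<integral>\<^sup>+x. ennreal (norm x * norm (dyadic_dilates \<phi>\<^sub>0 \<phi> i x)) \<partial>lborel)
      = ennreal ((1/2) ^ i * 2 ^ (i * CARD('n))) *
        (\<integral>\<^sup>+x. ennreal (norm (0 + 2 ^ i *\<^sub>R x) * norm (\<phi> (0 + 2 ^ i *\<^sub>R x))) \<partial>lborel)"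
    unfolding e1 by (rule nn_integral_cmult) measurable
  also have "ennreal ((1/2) ^ i * 2 ^ (i * CARD('n))) = ennreal ((1/2) ^ i) * ennreal (2 ^ (i * CARD('n)))"
    by (rule ennreal_mult) auto
  also have "\<dots> * (\<integral>\<^sup>+x. ennreal (norm (0 + 2 ^ i *\<^sub>R x) * norm (\<phi> (0 + 2 ^ i *\<^sub>R x))) \<partial>lborel)
      = ennreal ((1/2) ^ i) * (\<integral>\<^sup>+x. ennreal (norm x * norm (\<phi> x)) \<partial>lborel)"
    unfolding pw[symmetric] mult.assoc
    by (subst nn_integral_affine[where c="2 ^ i" and t=0 and g="\<lambda>x. ennreal (norm x * norm (\<phi> x))"]) auto
  finally show "(\<integral>\<^sup>+x. ennreal (norm x * norm (dyadic_dilates \<phi>\<^sub>0 \<phi> i x)) \<partial>lborel)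
       = ennreal ((1/2) ^ i) * (\<integral>\<^sup>+x. ennreal (norm x * norm (\<phi> x)) \<partial>lborel)" .
  show "(\<integral>x. dyadic_dilates \<phi>\<^sub>0 \<phi> i x \<partial>lborel) = (\<integral>x. \<phi> x \<partial>lborel)"
    unfolding d pw[symmetric]
    by (subst integral_affine[where c="2 ^ i" and t=0 and g=\<phi>]) (auto simp: scaleR_conv_of_real)
qed

section \<open>Dyadic cubes\<close>

lemma edge_length_pos: "0 < edge_length j"
  by (simp add: edge_length_def)

lemma dyadic_cube_borel [measurable]: "dyadic_cube j k \<in> sets borel"
  unfolding dyadic_cube_def by measurable

text \<open>A half-open cube lies between the open and the closed box with the same corners, which have the same
  measure.\<close>

lemma emeasure_dyadic_cube:
  fixes k :: "int^'n::finite"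
  shows "emeasure lborel (dyadic_cube j k) = ennreal (edge_length j ^ CARD('n))"
proof -
  define a b :: "real^'n" where "a = (\<chi> i. edge_length j * of_int (k $ i))"
    and "b = (\<chi> i. edge_length j * (of_int (k $ i) + 1))"
  have le: "a \<bullet> i \<le> b \<bullet> i" if "i \<in> Basis" for i
    using that edge_length_pos[of j] by (auto simp: Basis_vec_def a_def b_def inner_axis)
  have "(\<Prod>i\<in>Basis. (b - a) \<bullet> i) = (\<Prod>i\<in>(Basis::(real^'n) set). edge_length j)"
    by (intro prod.cong) (auto simp: Basis_vec_def a_def b_def inner_axis algebra_simps)
  then have v: "(\<Prod>i\<in>Basis. (b - a) \<bullet> i) = edge_length j ^ CARD('n)" by simp
  have "box a b \<subseteq> dyadic_cube j k" "dyadic_cube j k \<subseteq> cbox a b"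
    by (auto simp: mem_box_cart dyadic_cube_def a_def b_def less_imp_le)
  then have "emeasure lborel (box a b) \<le> emeasure lborel (dyadic_cube j k)"
    "emeasure lborel (dyadic_cube j k) \<le> emeasure lborel (cbox a b)"
    by (auto intro!: emeasure_mono)
  then show ?thesis
    using le by (simp add: emeasure_lborel_box_eq emeasure_lborel_cbox_eq v)
qed

lemma measure_dyadic_cube:
  fixes k :: "int^'n::finite"
  shows "measure lebesgue (dyadic_cube j k) = edge_length j ^ CARD('n)"
  using edge_length_pos[of j] by (simp add: measure_def emeasure_dyadic_cube)

lemma bounded_cover_by_unit_cubes:
  fixes S :: "(real^'n::finite) set"
  assumes "bounded S"
  obtains K :: "(int^'n) set" where "finite K" "S \<subseteq> (\<Union>k\<in>K. dyadic_cube 0 k)"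
proof -
  obtain R where R: "\<And>x. x \<in> S \<Longrightarrow> norm x \<le> R" using assms bounded_iff by blast
  define K where "K = vec_lambda ` (UNIV \<rightarrow>\<^sub>E {- \<lceil>R\<rceil> - 1..\<lceil>R\<rceil> + 1} :: ('n \<Rightarrow> int) set)"
  show thesis
  proof
    show "finite K" unfolding K_def by (intro finite_imageI finite_PiE) auto
    show "S \<subseteq> (\<Union>k\<in>K. dyadic_cube 0 k)"
    proof
      fix x assume x: "x \<in> S"
      have "\<lfloor>x $ i\<rfloor> \<in> {- \<lceil>R\<rceil> - 1..\<lceil>R\<rceil> + 1}" for i
        using component_le_norm_cart[of x i] R[OF x] by (simp; linarith)
      then have "(\<chi> i. \<lfloor>x $ i\<rfloor>) \<in> K" unfolding K_def by (intro imageI) auto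
      moreover have "x \<in> dyadic_cube 0 (\<chi> i. \<lfloor>x $ i\<rfloor>)"
        by (simp add: dyadic_cube_def edge_length_def)
      ultimately show "x \<in> (\<Union>k\<in>K. dyadic_cube 0 k)" by blast
    qed
  qed
qed

section \<open>From small shifts and small cubes to all shifts and all cubes\<close>

text \<open>For shifts of length at least \<open>1/2\<close> the trivial bound by the volume of the cube has the required
  form, because the edge length is at most one.\<close>

lemma jump_cube_le:
  fixes E :: "(real^'n::finite) set"
  assumes [measurable]: "E \<in> sets borel" and c: "0 < c" and j: "0 \<le> j"
    and diff: "\<And>t h. 0 < t \<Longrightarrow> t < 1 \<Longrightarrow> t / 2 < norm h \<Longrightarrow> norm h < t \<Longrightarrow>
      (\<integral>\<^sup>+x\<in>dyadic_cube j k. jump E h x \<partial>lborel) \<le> ennreal (c * t * edge_length j ^ (CARD('n) - 1))"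
  shows "(\<integral>\<^sup>+x\<in>dyadic_cube j k. jump E h x \<partial>lborel)
    \<le> ennreal ((2 * c + 2) * edge_length j ^ (CARD('n) - 1) * norm h)"
proof -
  let ?l = "edge_length j ^ (CARD('n) - 1)"
  have l0: "0 \<le> ?l" using edge_length_pos[of j] by simp
  consider "h = 0" | "h \<noteq> 0" "norm h < 1/2" | "1/2 \<le> norm h" by linarith
  then show ?thesis
  proof cases
    case 1
    then show ?thesis by (simp add: difference_def)
  next
    case 2
    \<comment> \<open>\<open>t = 3/2 * norm h\<close> satisfies \<open>t / 2 < norm h < t < 1\<close>.\<close>
    have "(\<integral>\<^sup>+x\<in>dyadic_cube j k. jump E h x \<partial>lborel) \<le> ennreal (c * (3/2 * norm h) * ?l)"
      using 2 by (intro diff) auto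
    also have "\<dots> \<le> ennreal ((2 * c + 2) * ?l * norm h)"
    proof (rule ennreal_leI)
      have "c * (3/2) * (?l * norm h) \<le> (2 * c + 2) * (?l * norm h)"
        using c l0 by (intro mult_right_mono) auto
      then show "c * (3/2 * norm h) * ?l \<le> (2 * c + 2) * ?l * norm h" by (simp add: mult_ac)
    qed
    finally show ?thesis .
  next
    case 3
    have "(\<integral>\<^sup>+x\<in>dyadic_cube j k. jump E h x \<partial>lborel) \<le> (\<integral>\<^sup>+x. indicator (dyadic_cube j k) x \<partial>lborel)"
      by (intro nn_integral_mono) (auto simp: difference_def split: split_indicator)
    also have "\<dots> = ennreal (edge_length j ^ CARD('n))" by (simp add: emeasure_dyadic_cube)
    also have "\<dots> \<le> ennreal ((2 * c + 2) * ?l * norm h)"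
    proof (rule ennreal_leI)
      have "edge_length j \<le> 1" using j by (simp add: edge_length_def power_int_minus one_le_power_int inverse_le_1_iff)
      then have "edge_length j ^ CARD('n) \<le> 1 * ?l"
        using mult_right_mono[OF _ l0, of "edge_length j" 1] by (subst power_eq_if) simp
      also have "\<dots> \<le> ((2 * c + 2) * norm h) * ?l"
      proof (rule mult_right_mono[OF _ l0])
        have "1 \<le> 2 * norm h" using 3 by simp
        also have "\<dots> \<le> (2 * c + 2) * norm h" using c by (intro mult_right_mono) auto
        finally show "1 \<le> (2 * c + 2) * norm h" .
      qed
      finally show "edge_length j ^ CARD('n) \<le> (2 * c + 2) * ?l * norm h" by (simp add: mult_ac)
    qed
    finally show ?thesis .
  qed
qed

text \<open>For a shift of length at most one the difference vanishes outside a fixed ball, which finitely many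
  unit cubes cover; for a longer shift its \<open>L\<^sup>1\<close> norm is at most twice the measure of the set.\<close>

lemma jump_global_le:
  fixes E :: "(real^'n::finite) set"
  assumes [measurable]: "E \<in> sets borel" and bdd: "bounded E" and c: "0 < c"
    and cube: "\<And>k h. (\<integral>\<^sup>+x\<in>dyadic_cube 0 k. jump E h x \<partial>lborel) \<le> ennreal (c * norm h)"
  obtains C where "0 < C" "\<And>h. (\<integral>\<^sup>+x. jump E h x \<partial>lborel) \<le> ennreal (C * norm h)"
proof -
  obtain R where R: "\<And>x. x \<in> E \<Longrightarrow> norm x \<le> R" using bdd bounded_iff by blast
  obtain K :: "(int^'n) set" where K: "finite K" "cball 0 (R + 1) \<subseteq> (\<Union>k\<in>K. dyadic_cube 0 k)"
    using bounded_cover_by_unit_cubes[of "cball (0::real^'n) (R + 1)"] bounded_cball by blast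
  have fm: "E \<in> lmeasurable"
    using bdd by (intro bounded_set_imp_lmeasurable) auto
  define V where "V = measure lebesgue E"
  have V: "emeasure lborel E = ennreal V"
    using fm unfolding V_def by (subst emeasure_eq_measure2[symmetric]) (auto simp: fmeasurable_def)
  have V0: "0 \<le> V" by (simp add: V_def)
  define C where "C = real (card K) * c + 2 * V + 1"
  show thesis
  proof
    show "0 < C" using c V0 by (simp add: C_def add_nonneg_pos)
    fix h
    show "(\<integral>\<^sup>+x. jump E h x \<partial>lborel) \<le> ennreal (C * norm h)"
    proof (cases "norm h \<le> 1")
      case True
      have "jump E h x \<le> (\<Sum>k\<in>K. jump E h x * indicator (dyadic_cube 0 k) x)" for x
      proof (cases "x \<in> cball 0 (R + 1)")
        case True
        then obtain k where k: "k \<in> K" "x \<in> dyadic_cube 0 k" using K by blast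
        have "jump E h x = jump E h x * indicator (dyadic_cube 0 k) x" using k by simp
        also have "\<dots> \<le> (\<Sum>k\<in>K. jump E h x * indicator (dyadic_cube 0 k) x)"
          using K k by (intro member_le_sum) auto
        finally show ?thesis .
      next
        case False
        have "norm x \<le> norm (x + h) + norm h" using norm_triangle_ineq4[of "x + h" h] by simp
        then have "x \<notin> E" "x + h \<notin> E" using False R[of x] R[of "x + h"] \<open>norm h \<le> 1\<close> by auto
        then show ?thesis by (simp add: difference_def)
      qed
      then have "(\<integral>\<^sup>+x. jump E h x \<partial>lborel)
          \<le> (\<integral>\<^sup>+x. (\<Sum>k\<in>K. jump E h x * indicator (dyadic_cube 0 k) x) \<partial>lborel)"
        by (intro nn_integral_mono)
      also have "\<dots> = (\<Sum>k\<in>K. (\<integral>\<^sup>+x\<in>dyadic_cube 0 k. jump E h x \<partial>lborel))"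
        by (rule nn_integral_sum) measurable
      also have "\<dots> \<le> (\<Sum>k\<in>K. ennreal (c * norm h))"
        by (intro sum_mono cube)
      also have "\<dots> = ennreal (real (card K) * c * norm h)"
        using c by (simp add: ennreal_mult ennreal_of_nat_eq_real_of_nat mult_ac)
      also have "\<dots> \<le> ennreal (C * norm h)"
        using V0 by (intro ennreal_leI mult_right_mono) (auto simp: C_def)
      finally show ?thesis .
    next
      case False
      have "(\<integral>\<^sup>+x. jump E h x \<partial>lborel) \<le> (\<integral>\<^sup>+x. indicator E (x + h) + indicator E x \<partial>lborel)"
        by (intro nn_integral_mono) (auto simp: difference_def split: split_indicator)
      also have "\<dots> = (\<integral>\<^sup>+x. indicator E (x + h) \<partial>lborel) + (\<integral>\<^sup>+x. indicator E x \<partial>lborel)"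
        by (rule nn_integral_add) measurable
      also have "(\<integral>\<^sup>+x. indicator E (x + h) \<partial>lborel) = (\<integral>\<^sup>+x. indicator E x \<partial>lborel)"
        using nn_integral_affine[of "indicator E" 1 h] by (simp add: add.commute)
      also have "\<dots> + (\<integral>\<^sup>+x. indicator E x \<partial>lborel) = ennreal (2 * V)"
        using V0 by (simp add: V ennreal_plus[symmetric] del: ennreal_plus)
      also have "\<dots> \<le> ennreal (C * norm h)"
      proof (rule ennreal_leI)
        have "2 * V * 1 \<le> C * norm h"
          using False V0 c by (intro mult_mono) (auto simp: C_def)
        then show "2 * V \<le> C * norm h" by simp
      qed
      finally show ?thesis .
    qed
  qed
qed

lemma edge_length_powr: "edge_length j = 2 powr (- of_int j)"
  using powr_real_of_int'[of 2 "- j"] by (simp add: edge_length_def)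

text \<open>Both regimes in one formula: \<open>nat j\<close> is \<open>max j 0\<close>, so that cubes with edge length above one are
  treated like unit cubes, and for them the global estimate is used.\<close>

lemma jump_local_le:
  fixes E :: "(real^'n::finite) set"
  assumes E: "E \<in> sets borel" and bdd: "bounded E" and c: "0 < c"
    and diff: "\<And>j k t h. 0 \<le> j \<Longrightarrow> 0 < t \<Longrightarrow> t < 1 \<Longrightarrow> t / 2 < norm h \<Longrightarrow> norm h < t \<Longrightarrow>
      (\<integral>\<^sup>+x\<in>dyadic_cube j k. jump E h x \<partial>lborel) \<le> ennreal (c * t * edge_length j ^ (CARD('n) - 1))"
  obtains C where "0 < C" "\<And>j k h. (\<integral>\<^sup>+x\<in>dyadic_cube j k. jump E h x \<partial>lborel)
      \<le> ennreal (C * 2 powr (- (real CARD('n) - 1) * real (nat j)) * norm h)"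
proof -
  have cube: "(\<integral>\<^sup>+x\<in>dyadic_cube j k. jump E h x \<partial>lborel)
      \<le> ennreal ((2 * c + 2) * edge_length j ^ (CARD('n) - 1) * norm h)" if "0 \<le> j" for j k h
    by (rule jump_cube_le[OF E c that diff[OF that]])
  have c2: "0 < 2 * c + 2" using c by simp
  have "(\<integral>\<^sup>+x\<in>dyadic_cube 0 k. jump E h x \<partial>lborel) \<le> ennreal ((2 * c + 2) * norm h)" for k h
    using cube[where j=0 and k=k and h=h] by (simp add: edge_length_def)
  then obtain D where D: "0 < D" "\<And>h. (\<integral>\<^sup>+x. jump E h x \<partial>lborel) \<le> ennreal (D * norm h)"
    using jump_global_le[OF E bdd c2] by metis
  show thesis
  proof (rule that[of "2 * c + 2 + D"])
    show "0 < 2 * c + 2 + D" using c D by simp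
    fix j :: int and k :: "int^'n" and h :: "real^'n"
    have mono: "ennreal (a * b * norm h) \<le> ennreal ((2 * c + 2 + D) * b * norm h)"
      if "a \<le> 2 * c + 2 + D" "0 \<le> b" for a b
      using that by (intro ennreal_leI mult_right_mono) auto
    show "(\<integral>\<^sup>+x\<in>dyadic_cube j k. jump E h x \<partial>lborel)
      \<le> ennreal ((2 * c + 2 + D) * 2 powr (- (real CARD('n) - 1) * real (nat j)) * norm h)"
    proof (cases "0 \<le> j")
      case True
      have l: "edge_length j ^ (CARD('n) - 1) = 2 powr (- (real CARD('n) - 1) * real (nat j))"
        using True unfolding edge_length_powr
        by (simp add: powr_power of_nat_diff Suc_leI algebra_simps)
      have "(\<integral>\<^sup>+x\<in>dyadic_cube j k. jump E h x \<partial>lborel)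
          \<le> ennreal ((2 * c + 2) * 2 powr (- (real CARD('n) - 1) * real (nat j)) * norm h)"
        using cube[OF True, where k=k and h=h] unfolding l .
      also have "\<dots> \<le> ennreal ((2 * c + 2 + D) * 2 powr (- (real CARD('n) - 1) * real (nat j)) * norm h)"
        using D(1) by (intro mono) auto
      finally show ?thesis .
    next
      case False
      have "(\<integral>\<^sup>+x\<in>dyadic_cube j k. jump E h x \<partial>lborel) \<le> (\<integral>\<^sup>+x. jump E h x \<partial>lborel)"
        by (intro nn_integral_mono) (auto split: split_indicator)
      also have "\<dots> \<le> ennreal (D * 1 * norm h)" using D by simp
      also have "\<dots> \<le> ennreal ((2 * c + 2 + D) * 1 * norm h)"
        using c by (intro mono) auto
      finally show ?thesis using False by simp
    qed
  qed
qed

section \<open>Passage from Lebesgue to Borel sets\<close>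

text \<open>The interchange of integrations needs \<open>(h, x) \<mapsto> indicator E (x + h)\<close> to be measurable for the product
  of the Borel \<open>\<sigma>\<close>-algebras. A Borel set that differs from \<open>E\<close> by a null set has, for each fixed
  shift, almost everywhere the same differences.\<close>

lemma borel_representative:
  fixes E :: "(real^'n::finite) set"
  assumes "E \<in> sets lebesgue"
  obtains F where "F \<in> sets borel" "F \<subseteq> E" "AE x in lborel. x \<in> E \<longleftrightarrow> x \<in> F"
    "\<And>h. AE x in lborel. jump E h x = jump F h x"
proof -
  obtain F M N where F: "E = F \<union> M" "M \<subseteq> N" "N \<in> null_sets lborel" "F \<in> sets lborel"
    using sets_completionE[OF assms] by metis
  have [measurable]: "N \<in> sets borel" using F(3) by (auto simp: null_sets_def)
  have ae: "AE x in lborel. x \<notin> N" by (rule AE_not_in[OF F(3)])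
  have ae_h: "AE x in lborel. x + h \<notin> N" for h
  proof -
    have "AE x in distr lborel borel ((+) h). x \<notin> N"
      using ae by (subst lborel_distr_plus)
    then show ?thesis by (simp add: AE_distr_iff add.commute)
  qed
  show thesis
  proof
    show "F \<in> sets borel" "F \<subseteq> E" using F by auto
    show "AE x in lborel. x \<in> E \<longleftrightarrow> x \<in> F" using ae by eventually_elim (use F in auto)
    show "AE x in lborel. jump E h x = jump F h x" for h
      using ae ae_h[of h]
    proof eventually_elim
      case (elim x)
      then have "x \<in> E \<longleftrightarrow> x \<in> F" "x + h \<in> E \<longleftrightarrow> x + h \<in> F" using F by auto
      then show ?case by (simp add: difference_def indicator_def)
    qed
  qed
qed

lemma nn_integral_lebesgue_on:
  "P \<in> sets borel \<Longrightarrow> (\<integral>\<^sup>+x. f x \<partial>lebesgue_on P) = (\<integral>\<^sup>+x\<in>P. f x \<partial>lborel)"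
  by (simp add: nn_integral_restrict_space nn_integral_completion)

section \<open>The indicator function as a tempered distribution\<close>

lemma integrable_indicator_schwartz:
  assumes "E \<in> lmeasurable" and \<psi>: "\<psi> \<in> schwartz"
  shows "integrable lebesgue (\<lambda>x. indicator E x * \<psi> x)"
proof -
  obtain B where B: "0 < B" "\<And>x. schwartz_weight 0 [] \<psi> x \<le> B" using schwartz_decay[OF \<psi>] by metis
  have "integrable lebesgue (\<lambda>x. B * indicat_real E x)"
    using assms by (auto simp: fmeasurable_def)
  then show ?thesis
  proof (rule Bochner_Integration.integrable_bound)
    have "\<psi> \<in> borel_measurable lebesgue"
      by (intro measurable_completion) (simp add: schwartz_measurable[OF \<psi>])
    then show "(\<lambda>x. indicator E x * \<psi> x) \<in> borel_measurable lebesgue"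
      using assms by (intro borel_measurable_times borel_measurable_indicator) (auto simp: fmeasurable_def)
    show "AE x in lebesgue. norm (indicator E x * \<psi> x) \<le> norm (B * indicat_real E x)"
      using B by (intro AE_I2) (auto simp: schwartz_weight_def norm_mult split: split_indicator)
  qed
qed

text \<open>Convergence of test functions implies uniform convergence, and a set of finite measure integrates
  uniformly convergent sequences to the limit.\<close>

lemma regular_distribution_indicator_tempered:
  fixes E :: "(real^'n::finite) set"
  assumes E: "E \<in> lmeasurable"
  shows "regular_distribution (indicator E) \<in> tempered_distributions"
  unfolding tempered_distributions_def
proof (intro CollectI conjI ballI allI impI)
  let ?u = "regular_distribution (indicator E)"
  have u: "?u \<psi> = (\<integral>x. indicator E x * \<psi> x \<partial>lebesgue)" if "\<psi> \<in> schwartz" for \<psi>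
    using that by (simp add: regular_distribution_def)
  note int = integrable_indicator_schwartz[OF E]
  show "?u \<in> extensional schwartz" by (simp add: regular_distribution_def)
  show "?u (\<lambda>x. \<psi> x + \<eta> x) = ?u \<psi> + ?u \<eta>" if "\<psi> \<in> schwartz" "\<eta> \<in> schwartz" for \<psi> \<eta>
    using that int by (simp add: u schwartz_add distrib_left)
  show cm: "?u (\<lambda>x. a * \<psi> x) = a * ?u \<psi>" if "\<psi> \<in> schwartz" for a \<psi>
    using that by (simp add: u schwartz_cmult mult.left_commute)
  fix \<psi> and \<psi>' :: "real^'n \<Rightarrow> complex" assume r: "range \<psi> \<subseteq> schwartz" and \<psi>': "\<psi>' \<in> schwartz" and lim: "schwartz_lim \<psi> \<psi>'"
  define S where "S k = (SUP x. schwartz_weight 0 [] (\<lambda>y. \<psi> k y - \<psi>' y) x)" for k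
  have S: "S \<longlonglongrightarrow> 0" using lim unfolding schwartz_lim_def S_def by blast
  have bound: "norm (?u (\<psi> k) - ?u \<psi>') \<le> S k * measure lebesgue E" for k
  proof -
    have k: "\<psi> k \<in> schwartz" using r by auto
    have d: "(\<lambda>y. \<psi> k y - \<psi>' y) \<in> schwartz"
      using schwartz_add[OF k schwartz_cmult[OF \<psi>', of "-1"]] by simp
    have le: "norm (\<psi> k x - \<psi>' x) \<le> S k" for x
    proof -
      have "bdd_above (range (schwartz_weight 0 [] (\<lambda>y. \<psi> k y - \<psi>' y)))"
        by (intro bounded_imp_bdd_above schwartz_bounded_weight[OF d])
      then have "schwartz_weight 0 [] (\<lambda>y. \<psi> k y - \<psi>' y) x \<le> S k"
        unfolding S_def by (intro cSUP_upper) auto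
      then show ?thesis by (simp add: schwartz_weight_def)
    qed
    have "?u (\<psi> k) - ?u \<psi>' = (\<integral>x. indicator E x * (\<psi> k x - \<psi>' x) \<partial>lebesgue)"
      using int[OF k] int[OF \<psi>'] by (simp add: u k \<psi>' right_diff_distrib)
    also have "norm \<dots> \<le> (\<integral>x. S k * indicat_real E x \<partial>lebesgue)"
    proof (rule Bochner_Integration.integral_norm_bound_integral[OF int[OF d]])
      show "integrable lebesgue (\<lambda>x. S k * indicat_real E x)" using E by (auto simp: fmeasurable_def)
    qed (use le in \<open>auto simp: norm_mult split: split_indicator\<close>)
    also have "\<dots> = S k * measure lebesgue E" by simp
    finally show ?thesis .
  qed
  have "(\<lambda>k. S k * measure lebesgue E) \<longlonglongrightarrow> 0" using tendsto_mult_left_zero[OF S] .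
  then have "(\<lambda>k. ?u (\<psi> k) - ?u \<psi>') \<longlonglongrightarrow> 0"
    by (rule Lim_null_comparison[OF always_eventually[OF allI[OF bound]]])
  then show "(\<lambda>k. ?u (\<psi> k)) \<longlonglongrightarrow> ?u \<psi>'" by (rule LIM_zero_cancel)
qed

lemma convolve_indicator:
  fixes \<psi> :: "real^'n::finite \<Rightarrow> complex"
  assumes \<psi>: "\<psi> \<in> schwartz" and F [measurable]: "F \<in> sets borel" and ae: "AE x in lborel. x \<in> E \<longleftrightarrow> x \<in> F"
    and E: "E \<in> sets lebesgue"
  shows "convolve \<psi> (regular_distribution (indicator E)) x = (\<integral>y. indicator F y * \<psi> (x - y) \<partial>lborel)"
proof -
  have [measurable]: "\<psi> \<in> borel_measurable borel" using \<psi> by measurable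
  have "convolve \<psi> (regular_distribution (indicator E)) x = (\<integral>y. indicator E y * \<psi> (x - y) \<partial>lebesgue)"
    by (simp add: convolve_def regular_distribution_def schwartz_reflect[OF \<psi>])
  also have "\<dots> = (\<integral>y. indicator F y * \<psi> (x - y) \<partial>lebesgue)"
  proof (rule integral_cong_AE)
    have m: "(\<lambda>y. \<psi> (x - y)) \<in> borel_measurable lebesgue" by (intro measurable_completion) measurable
    show "(\<lambda>y. indicator E y * \<psi> (x - y)) \<in> borel_measurable lebesgue"
      using E by (intro borel_measurable_times borel_measurable_indicator m)
    show "(\<lambda>y. indicator F y * \<psi> (x - y)) \<in> borel_measurable lebesgue"
      by (intro borel_measurable_times borel_measurable_indicator m) auto
    show "AE y in lebesgue. indicator E y * \<psi> (x - y) = indicator F y * \<psi> (x - y)"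
      using AE_completion[OF ae] by eventually_elim (simp add: indicator_def)
  qed
  also have "\<dots> = (\<integral>y. indicator F y * \<psi> (x - y) \<partial>lborel)"
    by (rule integral_completion) measurable
  finally show ?thesis .
qed

section \<open>Lebesgue and sequence norms\<close>

lemma ennreal_powr_mono: "x \<le> y \<Longrightarrow> 0 \<le> a \<Longrightarrow> ennreal_powr x a \<le> ennreal_powr y a"
  by (auto simp: ennreal_powr_def top_unique less_top intro!: ennreal_leI powr_mono2 enn2real_mono)

lemma ennreal_powr_ennreal: "0 \<le> x \<Longrightarrow> ennreal_powr (ennreal x) a = ennreal (x powr a)"
  by (simp add: ennreal_powr_def)

lemma ennreal_powr_one: "ennreal_powr x 1 = x"
  by (cases x) (auto simp: ennreal_powr_def)

lemma Lp_norm_mono_count_space: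
  assumes "\<And>x. x \<in> A \<Longrightarrow> f x \<le> g x"
  shows "Lp_norm q (count_space A) f \<le> Lp_norm q (count_space A) g"
proof (cases "q = \<infinity>")
  case True
  then show ?thesis
    using assms by (auto simp: Lp_norm_def AE_count_space intro!: esssup_AE_mono)
next
  case False
  then show ?thesis
    using assms by (auto simp: Lp_norm_def intro!: ennreal_powr_mono nn_integral_mono)
qed

lemma Lp_norm_lebesgue_on:
  assumes "0 < p" "P \<in> sets borel" "\<And>x. 0 \<le> f x"
  shows "Lp_norm (ennreal p) (lebesgue_on P) (\<lambda>x. ennreal (f x))
    = ennreal_powr (\<integral>\<^sup>+x\<in>P. ennreal (f x powr p) \<partial>lborel) (1 / p)"
  using assms by (simp add: Lp_norm_def ennreal_powr_ennreal nn_integral_lebesgue_on)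

lemma Lp_norm_1_lebesgue_on:
  assumes "P \<in> sets borel"
  shows "Lp_norm 1 (lebesgue_on P) f = (\<integral>\<^sup>+x\<in>P. f x \<partial>lborel)"
  using assms by (simp add: Lp_norm_def ennreal_powr_one nn_integral_lebesgue_on)

text \<open>The norm of a decaying geometric sequence over a tail is comparable to the first term of the tail.
  For \<open>q = \<infinity>\<close> a constant sequence is admitted too, which is the limiting smoothness \<open>1 / p\<close>.\<close>

lemma Lp_norm_geometric_le:
  assumes q: "1 \<le> q" and a: "0 < a \<or> (a = 0 \<and> q = \<infinity>)"
  obtains D where "0 \<le> D" "\<And>C J. 0 \<le> C \<Longrightarrow>
    Lp_norm q (count_space {i::nat. J \<le> i}) (\<lambda>i. ennreal (C * 2 powr (- a * real i)))
      \<le> ennreal (C * D * 2 powr (- a * real J))"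
proof (cases "q = \<infinity>")
  case True
  show thesis
  proof (rule that[of 1])
    fix C :: real and J assume "0 \<le> C"
    then show "Lp_norm q (count_space {i::nat. J \<le> i}) (\<lambda>i. ennreal (C * 2 powr (- a * real i)))
      \<le> ennreal (C * 1 * 2 powr (- a * real J))"
      using True a by (auto simp: Lp_norm_def AE_count_space intro!: esssup_I ennreal_leI mult_left_mono)
  qed simp
next
  case False
  define r where "r = enn2real q"
  have r: "1 \<le> r" using q False unfolding r_def by (cases q) (auto simp: one_ennreal_def[symmetric])
  have a0: "0 < a" using a False by simp
  define \<rho> where "\<rho> = 2 powr (- a * r)"
  have "2 powr (- a * r) < 2 powr 0" using a0 r by (intro powr_less_mono) auto
  then have \<rho>: "0 < \<rho>" "\<rho> < 1" by (auto simp: \<rho>_def)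
  show thesis
  proof (rule that[of "(1 / (1 - \<rho>)) powr (1 / r)"])
    fix C :: real and J assume C: "0 \<le> C"
    let ?X = "C * 2 powr (- a * real J)"
    have "(\<integral>\<^sup>+i. ennreal ((C * 2 powr (- a * real i)) powr r) \<partial>count_space {i. J \<le> i})
        = (\<integral>\<^sup>+m. ennreal ((C * 2 powr (- a * real (J + m))) powr r) \<partial>count_space UNIV)"
    proof (rule nn_integral_bij_count_space[symmetric])
      show "bij_betw ((+) J) UNIV {i. J \<le> i}"
        by (auto simp: bij_betw_def image_def le_iff_add)
    qed
    also have "\<dots> = (\<Sum>m. ennreal ((C * 2 powr (- a * real (J + m))) powr r))"
      by (rule nn_integral_count_space_nat)
    also have "\<dots> = (\<Sum>m. ennreal (?X powr r * \<rho> ^ m))"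
    proof (intro suminf_cong arg_cong[where f=ennreal])
      fix m
      have "2 powr (- a * real (J + m)) = 2 powr (- a * real J) * 2 powr (- a * real m)"
        by (simp add: powr_add[symmetric] algebra_simps)
      moreover have "(2 powr (- a * real m)) powr r = \<rho> ^ m"
        by (simp add: \<rho>_def powr_powr powr_power mult_ac)
      ultimately show "(C * 2 powr (- a * real (J + m))) powr r = ?X powr r * \<rho> ^ m"
        using C by (simp add: powr_mult mult.assoc[symmetric])
    qed
    also have "\<dots> = ennreal (?X powr r / (1 - \<rho>))"
      using \<rho> by (subst suminf_ennreal2)
        (auto intro!: summable_mult summable_geometric simp: suminf_mult suminf_geometric summable_geometric)
    finally have "Lp_norm q (count_space {i. J \<le> i}) (\<lambda>i. ennreal (C * 2 powr (- a * real i)))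
        = ennreal_powr (ennreal (?X powr r / (1 - \<rho>))) (1 / r)"
      using False C by (simp add: Lp_norm_def r_def[symmetric] ennreal_powr_ennreal)
    also have "\<dots> = ennreal ((?X powr r * (1 / (1 - \<rho>))) powr (1 / r))"
      using \<rho> by (simp add: ennreal_powr_ennreal)
    also have "(?X powr r * (1 / (1 - \<rho>))) powr (1 / r) = ?X * (1 / (1 - \<rho>)) powr (1 / r)"
      using \<rho> r C by (subst powr_mult) (auto simp: powr_powr)
    finally show "Lp_norm q (count_space {i::nat. J \<le> i}) (\<lambda>i. ennreal (C * 2 powr (- a * real i)))
      \<le> ennreal (C * (1 / (1 - \<rho>)) powr (1 / r) * 2 powr (- a * real J))"
      by (simp add: mult_ac)
  qed simp
qed

section \<open>Indicator functions in Besov-type spaces\<close>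

text \<open>The summation over the levels. On a cube of edge length \<open>2 powr (- J)\<close> the tail \<open>i \<ge> J\<close> contributes a
  multiple of its first term \<open>2 powr (J * (s - n / p))\<close>, and the factor \<open>1 / measure P powr \<tau>\<close> is
  \<open>2 powr (J * n * \<tau>)\<close>. The product is bounded in \<open>J \<ge> 0\<close> if \<open>s + n * \<tau> \<le> n / p\<close>. On
  cubes with edge length above one the tail starts at \<open>0\<close> and that factor is at most one.\<close>

lemma besov_type_spaceI:
  fixes \<phi>\<^sub>0 \<phi> :: "real^'n::finite \<Rightarrow> complex"
  assumes u: "u \<in> tempered_distributions" and C: "0 \<le> C" and \<tau>: "0 \<le> \<tau>" and p: "0 < p" and q: "1 \<le> q"
    and level: "\<And>j k i. nat j \<le> i \<Longrightarrow>
      Lp_norm (ennreal p) (lebesgue_on (dyadic_cube j k)) (\<lambda>x. ennreal (norm (convolve (dyadic_dilates \<phi>\<^sub>0 \<phi> i) u x)))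
      \<le> ennreal (C * 2 powr (- (real i + (real CARD('n) - 1) * real (nat j)) / p))"
    and s: "s < 1 / p \<or> (s = 1 / p \<and> q = \<infinity>)"
    and sum: "s + real CARD('n) * \<tau> \<le> real CARD('n) / p"
  shows "u \<in> besov_type_space \<phi>\<^sub>0 \<phi> s \<tau> (ennreal p) q"
proof -
  define n where "n = real CARD('n)"
  have "0 < 1 / p - s \<or> (1 / p - s = 0 \<and> q = \<infinity>)" using s by auto
  then obtain D where D: "0 \<le> D" "\<And>C J. 0 \<le> C \<Longrightarrow>
    Lp_norm q (count_space {i::nat. J \<le> i}) (\<lambda>i. ennreal (C * 2 powr (- (1 / p - s) * real i)))
      \<le> ennreal (C * D * 2 powr (- (1 / p - s) * real J))"
    using Lp_norm_geometric_le[OF q] by metis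
  have "besov_type_norm \<phi>\<^sub>0 \<phi> s \<tau> (ennreal p) q u \<le> ennreal (C * D)"
    unfolding besov_type_norm_def
  proof (intro SUP_least)
    fix j :: int and k :: "int^'n"
    define J where "J = nat j"
    let ?L = "\<lambda>i. Lp_norm (ennreal p) (lebesgue_on (dyadic_cube j k))
        (\<lambda>x. ennreal (norm (convolve (dyadic_dilates \<phi>\<^sub>0 \<phi> i) u x)))"
    let ?C = "C * 2 powr (- (n - 1) * real J / p)"
    have set: "{i::nat. max j 0 \<le> int i} = {i. J \<le> i}" by (auto simp: J_def)
    have "Lp_norm q (count_space {i. J \<le> i}) (\<lambda>i. ennreal (2 powr (real i * s)) * ?L i)
        \<le> Lp_norm q (count_space {i. J \<le> i}) (\<lambda>i. ennreal (?C * 2 powr (- (1 / p - s) * real i)))"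
    proof (rule Lp_norm_mono_count_space)
      fix i assume "i \<in> {i. J \<le> i}"
      then have "ennreal (2 powr (real i * s)) * ?L i
          \<le> ennreal (2 powr (real i * s)) * ennreal (C * 2 powr (- (real i + (n - 1) * real J) / p))"
        unfolding n_def J_def by (intro mult_left_mono level) auto
      also have "\<dots> = ennreal (?C * 2 powr (- (1 / p - s) * real i))"
        using C by (simp add: ennreal_mult[symmetric] powr_add[symmetric] algebra_simps add_divide_distrib diff_divide_distrib)
      finally show "ennreal (2 powr (real i * s)) * ?L i \<le> \<dots>" .
    qed
    also have "\<dots> \<le> ennreal (?C * D * 2 powr (- (1 / p - s) * real J))"
      using C by (intro D) simp
    finally have 1: "Lp_norm q (count_space {i. J \<le> i}) (\<lambda>i. ennreal (2 powr (real i * s)) * ?L i) \<le> \<dots>" .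
    have "1 / measure lebesgue (dyadic_cube j k) powr \<tau> = 2 powr (of_int j * (n * \<tau>))"
      by (simp add: measure_dyadic_cube edge_length_powr powr_power powr_powr powr_minus_divide[symmetric] n_def mult_ac)
    also have "\<dots> \<le> 2 powr (real J * (n * \<tau>))"
      using \<tau> by (intro powr_mono mult_right_mono) (auto simp: J_def n_def)
    finally have 2: "ennreal (1 / measure lebesgue (dyadic_cube j k) powr \<tau>) \<le> ennreal (2 powr (real J * (n * \<tau>)))"
      by (rule ennreal_leI)
    have "ennreal (1 / measure lebesgue (dyadic_cube j k) powr \<tau>) *
        Lp_norm q (count_space {i. J \<le> i}) (\<lambda>i. ennreal (2 powr (real i * s)) * ?L i)
      \<le> ennreal (2 powr (real J * (n * \<tau>))) * ennreal (?C * D * 2 powr (- (1 / p - s) * real J))"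
      by (intro mult_mono 1 2) auto
    also have "\<dots> = ennreal (C * D * 2 powr (real J * (s + n * \<tau> - n / p)))"
      using C D(1) by (simp add: ennreal_mult[symmetric] powr_add[symmetric] algebra_simps diff_divide_distrib)
    also have "\<dots> \<le> ennreal (C * D * 2 powr 0)"
      using C D(1) sum by (intro ennreal_leI mult_left_mono powr_mono mult_nonneg_nonpos) (auto simp: n_def)
    finally show "ennreal (1 / measure lebesgue (dyadic_cube j k) powr \<tau>) *
        Lp_norm q (count_space {i. max j 0 \<le> int i}) (\<lambda>i. ennreal (2 powr (real i * s)) * ?L i) \<le> ennreal (C * D)"
      unfolding set by simp
  qed
  also have "\<dots> < \<infinity>" by simp
  finally show ?thesis using u by (simp add: besov_type_space_def)
qed

text \<open>The estimate for one level. Level \<open>0\<close> occurs only with \<open>nat j = 0\<close>, where no decay is claimed, so the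
  lack of cancellation in \<open>\<phi>\<^sub>0\<close> does no harm.\<close>

lemma Lp_norm_level_le:
  fixes \<phi>\<^sub>0 \<phi> :: "real^'n::finite \<Rightarrow> complex"
  assumes adm: "admissible_pair \<phi>\<^sub>0 \<phi>" and p: "1 \<le> p"
    and F [measurable]: "F \<in> sets borel" and bdd: "bounded F" and M: "0 < M"
    and jump: "\<And>j k h. (\<integral>\<^sup>+x\<in>dyadic_cube j k. jump F h x \<partial>lborel)
      \<le> ennreal (M * 2 powr (- (real CARD('n) - 1) * real (nat j)) * norm h)"
  obtains C where "0 \<le> C" "\<And>j k i. nat j \<le> i \<Longrightarrow>
    Lp_norm (ennreal p) (lebesgue_on (dyadic_cube j k))
      (\<lambda>x. ennreal (norm (\<integral>y. indicator F y * dyadic_dilates \<phi>\<^sub>0 \<phi> i (x - y) \<partial>lborel)))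
    \<le> ennreal (C * 2 powr (- (real i + (real CARD('n) - 1) * real (nat j)) / p))"
proof -
  note s0 = admissible_pairD(1)[OF adm] and s = admissible_pairD(2)[OF adm]
  note [measurable] = schwartz_measurable[OF s0] schwartz_measurable[OF s]
  have fin: "(\<integral>\<^sup>+x. ennreal (norm (f x)) \<partial>lborel) < \<infinity>" "(\<integral>\<^sup>+x. ennreal (norm x * norm (f x)) \<partial>lborel) < \<infinity>"
    if "f \<in> schwartz" for f :: "real^'n \<Rightarrow> complex"
    by (rule le_less_trans[OF _ nn_integral_schwartz_finite[OF that]],
        intro nn_integral_mono ennreal_leI, simp add: distrib_right)+
  define A0 A B V where "A0 = enn2real (\<integral>\<^sup>+x. ennreal (norm (\<phi>\<^sub>0 x)) \<partial>lborel)"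
    and "A = enn2real (\<integral>\<^sup>+x. ennreal (norm (\<phi> x)) \<partial>lborel)"
    and "B = enn2real (\<integral>\<^sup>+x. ennreal (norm x * norm (\<phi> x)) \<partial>lborel)"
    and "V = measure lborel F"
  have A0: "(\<integral>\<^sup>+x. ennreal (norm (\<phi>\<^sub>0 x)) \<partial>lborel) = ennreal A0" "0 \<le> A0"
    using fin(1)[OF s0] by (auto simp: A0_def)
  have A: "(\<integral>\<^sup>+x. ennreal (norm (\<phi> x)) \<partial>lborel) = ennreal A" "0 \<le> A"
    using fin(1)[OF s] by (auto simp: A_def)
  have B: "(\<integral>\<^sup>+x. ennreal (norm x * norm (\<phi> x)) \<partial>lborel) = ennreal B" "0 \<le> B"
    using fin(2)[OF s] by (auto simp: B_def)
  have V: "emeasure lborel F = ennreal V" "0 \<le> V"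
    using emeasure_bounded_finite[OF bdd] by (auto simp: V_def emeasure_eq_ennreal_measure less_top)
  define W where "W = A0 powr (p - 1) * (V * A0) + A powr (p - 1) * (M * B)"
  have W: "0 \<le> W" using A0 A B V M by (simp add: W_def)
  have main: "(\<integral>\<^sup>+x\<in>dyadic_cube j k. ennreal (norm (\<integral>y. indicator F y * dyadic_dilates \<phi>\<^sub>0 \<phi> i (x - y) \<partial>lborel) powr p) \<partial>lborel)
      \<le> ennreal (W * 2 powr (- (real i + (real CARD('n) - 1) * real (nat j))))"
    if i: "nat j \<le> i" for j i and k :: "int^'n"
  proof (cases "i = 0")
    case True
    have "(\<integral>\<^sup>+x\<in>dyadic_cube j k. ennreal (norm (\<integral>y. indicator F y * \<phi>\<^sub>0 (x - y) \<partial>lborel) powr p) \<partial>lborel)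
        \<le> (\<integral>\<^sup>+x. ennreal (norm (\<integral>y. indicator F y * \<phi>\<^sub>0 (x - y) \<partial>lborel) powr p) \<partial>lborel)"
      by (intro nn_integral_mono) (auto split: split_indicator)
    also have "\<dots> \<le> ennreal (A0 powr (p - 1) * (V * A0))"
      using A0 V p by (intro nn_integral_convolution_powr_le) auto
    also have "\<dots> \<le> ennreal W"
      using A B M by (intro ennreal_leI) (simp add: W_def)
    finally show ?thesis using True i by (simp add: dyadic_dilates_def)
  next
    case False
    then have i0: "0 < i" by simp
    let ?\<psi> = "dyadic_dilates \<phi>\<^sub>0 \<phi> i" and ?K = "M * 2 powr (- (real CARD('n) - 1) * real (nat j))"
    note mom = dyadic_dilates_moments[OF schwartz_measurable[OF s] i0, of \<phi>\<^sub>0]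
    have "(\<integral>\<^sup>+x\<in>dyadic_cube j k. ennreal (norm (\<integral>y. indicator F y * ?\<psi> (x - y) \<partial>lborel) powr p) \<partial>lborel)
        \<le> ennreal (A powr (p - 1) * (?K * ((1/2) ^ i * B)))"
    proof (rule nn_integral_mean_zero_convolution_powr_le)
      show "?\<psi> \<in> borel_measurable borel"
        by (rule schwartz_measurable[OF schwartz_dyadic_dilates[OF s0 s]])
      show "(\<integral>h. ?\<psi> h \<partial>lborel) = 0" using mom(3) integral_admissible_eq_0[OF adm] by simp
      show "(\<integral>\<^sup>+h. ennreal (norm (?\<psi> h)) \<partial>lborel) \<le> ennreal A" using mom(1) A by simp
      show "(\<integral>\<^sup>+h. ennreal (norm h * norm (?\<psi> h)) \<partial>lborel) \<le> ennreal ((1/2) ^ i * B)"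
        using mom(2) B by (simp add: ennreal_mult)
      show "(\<integral>\<^sup>+x\<in>dyadic_cube j k. jump F h x \<partial>lborel) \<le> ennreal (?K * norm h)" for h
        by (rule jump)
    qed (use A B M p in auto)
    also have "A powr (p - 1) * (?K * ((1/2) ^ i * B))
        = A powr (p - 1) * (M * B) * 2 powr (- (real i + (real CARD('n) - 1) * real (nat j)))"
    proof -
      have half: "(1/2) ^ i = 2 powr (- real i)" by (simp add: powr_minus_divide powr_realpow power_one_over)
      have split: "2 powr (- (real CARD('n) - 1) * real (nat j)) * 2 powr (- real i)
          = 2 powr (- (real i + (real CARD('n) - 1) * real (nat j)))"
        by (simp add: powr_add[symmetric] algebra_simps)
      show ?thesis unfolding half split[symmetric] by (simp only: mult_ac)
    qed
    also have "ennreal \<dots> \<le> ennreal (W * 2 powr (- (real i + (real CARD('n) - 1) * real (nat j))))"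
      using A0 V by (intro ennreal_leI mult_right_mono) (auto simp: W_def)
    finally show ?thesis .
  qed
  show thesis
  proof (rule that[of "W powr (1 / p)"])
    fix j :: int and k :: "int^'n" and i :: nat assume i: "nat j \<le> i"
    let ?e = "- (real i + (real CARD('n) - 1) * real (nat j))"
    have "Lp_norm (ennreal p) (lebesgue_on (dyadic_cube j k))
      (\<lambda>x. ennreal (norm (\<integral>y. indicator F y * dyadic_dilates \<phi>\<^sub>0 \<phi> i (x - y) \<partial>lborel)))
      = ennreal_powr (\<integral>\<^sup>+x\<in>dyadic_cube j k. ennreal (norm (\<integral>y. indicator F y *
          dyadic_dilates \<phi>\<^sub>0 \<phi> i (x - y) \<partial>lborel) powr p) \<partial>lborel) (1 / p)"
      using p by (intro Lp_norm_lebesgue_on) auto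
    also have "\<dots> \<le> ennreal_powr (ennreal (W * 2 powr ?e)) (1 / p)"
      using p by (intro ennreal_powr_mono main[OF i]) auto
    also have "\<dots> = ennreal (W powr (1 / p) * 2 powr (?e / p))"
      using W by (simp add: ennreal_powr_ennreal powr_mult powr_powr)
    finally show "Lp_norm (ennreal p) (lebesgue_on (dyadic_cube j k))
      (\<lambda>x. ennreal (norm (\<integral>y. indicator F y * dyadic_dilates \<phi>\<^sub>0 \<phi> i (x - y) \<partial>lborel))) \<le> \<dots>" .
  qed simp
qed

theorem theorem4p21:
  fixes E :: "(real^'n::finite) set" and \<phi>\<^sub>0 \<phi> :: "real^'n \<Rightarrow> complex" and p c :: real
  assumes adm: "admissible_pair \<phi>\<^sub>0 \<phi>"
    and bdd: "bounded E" and meas: "E \<in> sets lebesgue"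
    and p: "1 \<le> p"
    and c: "0 < c"
    and diff: "\<And>(j::int) (k::int^'n) (t::real).
      \<lbrakk>measure lebesgue (dyadic_cube j k) \<le> 1; 0 < t; t < 1\<rbrakk> \<Longrightarrow>
      (SUP h\<in>{h::real^'n. t / 2 < norm h \<and> norm h < t}.
          Lp_norm 1 (lebesgue_on (dyadic_cube j k))
            (\<lambda>x. ennreal \<bar>difference h (indicat_real E) x\<bar>))
        \<le> ennreal (c * t * edge_length j ^ (CARD('n) - 1))"
  shows "(\<forall>\<tau>. 0 < \<tau> \<and> \<tau> \<le> (real CARD('n) - 1) / (real CARD('n) * p) \<longrightarrow>
            regular_distribution (indicator E) \<in> besov_type_space \<phi>\<^sub>0 \<phi> (1 / p) \<tau> (ennreal p) \<infinity>)
       \<and> (\<forall>\<tau>. (real CARD('n) - 1) / (real CARD('n) * p) < \<tau> \<and> \<tau> < 1 / p \<longrightarrow>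
            (\<forall>q::ennreal. 1 \<le> q \<longrightarrow>
              regular_distribution (indicator E) \<in>
                besov_type_space \<phi>\<^sub>0 \<phi> (real CARD('n) * (1 / p - \<tau>)) \<tau> (ennreal p) q))"
proof -
  define n where "n = real CARD('n)"
  have n: "1 \<le> n" unfolding n_def by (simp add: Suc_leI)
  obtain F where F: "F \<in> sets borel" "F \<subseteq> E" "AE x in lborel. x \<in> E \<longleftrightarrow> x \<in> F"
    "\<And>h. AE x in lborel. jump E h x = jump F h x"
    using borel_representative[OF meas] by blast
  have bF: "bounded F" using bdd F(2) bounded_subset by blast
  have diffF: "(\<integral>\<^sup>+x\<in>dyadic_cube j k. jump F h x \<partial>lborel) \<le> ennreal (c * t * edge_length j ^ (CARD('n) - 1))"
    if "0 \<le> j" "0 < t" "t < 1" "t / 2 < norm h" "norm h < t" for j k t h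
  proof -
    have "edge_length j \<le> 1" using that(1) powr_mono[of "- of_int j" 0 2] by (simp add: edge_length_powr)
    then have m: "measure lebesgue (dyadic_cube j k) \<le> 1"
      using edge_length_pos[of j] by (simp add: measure_dyadic_cube power_le_one)
    have "(\<integral>\<^sup>+x\<in>dyadic_cube j k. jump F h x \<partial>lborel) = (\<integral>\<^sup>+x\<in>dyadic_cube j k. jump E h x \<partial>lborel)"
      by (intro nn_integral_cong_AE AE_mp[OF F(4)[of h] AE_I2]) simp
    also have "\<dots> = Lp_norm 1 (lebesgue_on (dyadic_cube j k)) (jump E h)"
      by (rule Lp_norm_1_lebesgue_on[symmetric]) measurable
    also have "\<dots> \<le> (SUP h\<in>{h::real^'n. t / 2 < norm h \<and> norm h < t}.
        Lp_norm 1 (lebesgue_on (dyadic_cube j k)) (jump E h))"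
      using that by (intro SUP_upper) auto
    also have "\<dots> \<le> ennreal (c * t * edge_length j ^ (CARD('n) - 1))"
      by (rule diff[OF m that(2,3)])
    finally show ?thesis .
  qed
  obtain M where M: "0 < M" "\<And>j k h. (\<integral>\<^sup>+x\<in>dyadic_cube j k. jump F h x \<partial>lborel)
      \<le> ennreal (M * 2 powr (- (real CARD('n) - 1) * real (nat j)) * norm h)"
    using jump_local_le[OF F(1) bF c diffF] by blast
  obtain C where C: "0 \<le> C" "\<And>j k i. nat j \<le> i \<Longrightarrow>
    Lp_norm (ennreal p) (lebesgue_on (dyadic_cube j k))
      (\<lambda>x. ennreal (norm (\<integral>y. indicator F y * dyadic_dilates \<phi>\<^sub>0 \<phi> i (x - y) \<partial>lborel)))
    \<le> ennreal (C * 2 powr (- (real i + (real CARD('n) - 1) * real (nat j)) / p))"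
    using Lp_norm_level_le[OF adm p F(1) bF M] by blast
  let ?u = "regular_distribution (indicator E)"
  have conv: "convolve (dyadic_dilates \<phi>\<^sub>0 \<phi> i) ?u x
      = (\<integral>y. indicator F y * dyadic_dilates \<phi>\<^sub>0 \<phi> i (x - y) \<partial>lborel)" for i x
    by (rule convolve_indicator[OF schwartz_dyadic_dilates[OF admissible_pairD(1,2)[OF adm]] F(1,3) meas])
  have u: "?u \<in> tempered_distributions"
    by (intro regular_distribution_indicator_tempered bounded_set_imp_lmeasurable bdd meas)
  have p0: "0 < p" using p by simp
  \<comment> \<open>Both parts are instances: in the first \<open>s = 1 / p\<close> and the condition on \<open>\<tau>\<close> is the balance of
    exponents; in the second \<open>s\<close> makes the balance an equality and the condition on \<open>\<tau>\<close> gives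
    \<open>s < 1 / p\<close>.\<close>
  have besov: "?u \<in> besov_type_space \<phi>\<^sub>0 \<phi> s \<tau> (ennreal p) q"
    if "0 \<le> \<tau>" "1 \<le> q" "s < 1 / p \<or> (s = 1 / p \<and> q = \<infinity>)" "s + n * \<tau> \<le> n / p" for s \<tau> q
    using that by (intro besov_type_spaceI[OF u C(1) _ p0 _ C(2)[folded conv]]) (auto simp: n_def)
  show ?thesis
    unfolding n_def[symmetric]
  proof (intro conjI allI impI; elim conjE)
    fix \<tau> assume \<tau>: "0 < \<tau>" "\<tau> \<le> (n - 1) / (n * p)"
    have "n * \<tau> \<le> n * ((n - 1) / (n * p))" using \<tau> n by (intro mult_left_mono) auto
    also have "\<dots> = n / p - 1 / p" using n p0 by (simp add: field_simps)
    finally show "?u \<in> besov_type_space \<phi>\<^sub>0 \<phi> (1 / p) \<tau> (ennreal p) \<infinity>"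
      using \<tau> by (intro besov) auto
  next
    fix \<tau> and q :: ennreal assume \<tau>: "(n - 1) / (n * p) < \<tau>" "\<tau> < 1 / p" and q: "1 \<le> q"
    have "n / p - 1 / p = n * ((n - 1) / (n * p))" using n p0 by (simp add: field_simps)
    also have "\<dots> < n * \<tau>" using \<tau> n by (intro mult_strict_left_mono) auto
    finally have s: "n * (1 / p - \<tau>) < 1 / p" by (simp add: algebra_simps)
    have "0 \<le> (n - 1) / (n * p)" using n p0 by simp
    then show "?u \<in> besov_type_space \<phi>\<^sub>0 \<phi> (n * (1 / p - \<tau>)) \<tau> (ennreal p) q"
      using \<tau> q s by (intro besov) (auto simp: algebra_simps)
  qed
qed

end
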